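(* Let $p\equiv5\pmod{12}$, $m$ odd, $\Theta\in\mathrm{Aut}(R_k)$ with order dividing $p^s$, and $\alpha=\xi^{(p-1)/4}$ with $\xi$ a generator of $\mathbb{F}_p^*$. Then $x^{6p^s}+1=(x-\alpha)^{p^s}(x+\alpha)^{p^s}(x^2+\alpha x-1)^{p^s}(x^2+\alpha^{-1}x-1)^{p^s}$, and every skew $\Theta$-negacyclic code $\mathcal C$ of length $6p^s$ over $R_k$ decomposes as $\mathcal C=\mathcal C_1\oplus\mathcal C_2\oplus\mathcal C_3\oplus\mathcal C_4$, where $\mathcal C_1,\mathcal C_2,\mathcal C_3,\mathcal C_4$ are left ideals of $R_k[x;\Theta]/\langle(x-\alpha)^{p^s}\rangle$, $R_k[x;\Theta]/\langle(x+\alpha)^{p^s}\rangle$, $R_k[x;\Theta]/\langle(x^2+\alpha x-1)^{p^s}\rangle$, $R_k[x;\Theta]/\langle(x^2+\alpha^{-1}x-1)^{p^s}\rangle$ respectively. Then $|\mathcal C|=\prod_{i=1}^4|\mathcal C_i|$, and $\mathcal C^\perp=\mathcal C_1^\perp\oplus\mathcal C_2^\perp\oplus\mathcal C_3^\perp\oplus\mathcal C_4^\perp$, where $\mathcal C_1^\perp,\mathcal C_2^\perp$ are left ideals of $R_k[x;\Theta]/\langle(x+\alpha)^{p^s}\rangle$ and $R_k[x;\Theta]/\langle(x-\alpha)^{p^s}\rangle$, and $\mathcal C_3^\perp,\mathcal C_4^\perp$ are left ideals of $R_k[x;\Theta]/\langle(x^2+\alpha^{-1}x-1)^{p^s}\rangle$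 and $R_k[x;\Theta]/\langle(x^2+\alpha x-1)^{p^s}\rangle$. Moreover $\mathcal C$ is self-dual iff $\mathcal C_1=\mathcal C_2^\perp$, $\mathcal C_2=\mathcal C_1^\perp$, $\mathcal C_3=\mathcal C_4^\perp$, $\mathcal C_4=\mathcal C_3^\perp$.
   Context: $R_k=\mathbb{F}_{p^m}[u]/\langle u^k\rangle$; $R_k[x;\Theta]$ is the skew polynomial ring with $xa=\Theta(a)x$. A skew $\Theta$-negacyclic code of length $N$ is a left ideal of $R_k[x;\Theta]/\langle x^N+1\rangle$. The decomposition is via the Chinese Remainder isomorphism for the stated factorization into pairwise coprime central factors. $\mathcal C^\perp$ is the Euclidean dual (again skew $\Theta$-negacyclic) and $\mathcal C_i^\perp$ denotes its component in the indicated factor ring. *)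

theory Defs
  imports "HOL-Computational_Algebra.Polynomial" "HOL-Library.Cardinality"
begin

section \<open>The ring R_k = F[u]/(u^k), represented by polynomials of degree < k\<close>

definition Rk_carrier :: "nat \<Rightarrow> 'a::field poly set" where
  "Rk_carrier k = {a. degree a < k}"

definition Rk_mult :: "nat \<Rightarrow> 'a::field poly \<Rightarrow> 'a poly \<Rightarrow> 'a poly" where
  "Rk_mult k a b = (a * b) mod (monom 1 k)"

definition Rk_aut :: "nat \<Rightarrow> ('a::field poly \<Rightarrow> 'a poly) \<Rightarrow> bool" where
  "Rk_aut k \<Theta> \<longleftrightarrow> bij_betw \<Theta> (Rk_carrier k) (Rk_carrier k) \<and> \<Theta> 1 = 1 \<and>
     (\<forall>a\<in>Rk_carrier k. \<forall>b\<in>Rk_carrier k.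
        \<Theta> (a + b) = \<Theta> a + \<Theta> b \<and> \<Theta> (Rk_mult k a b) = Rk_mult k (\<Theta> a) (\<Theta> b))"

type_synonym 'a skp = "nat \<Rightarrow> 'a poly"

definition skp_carrier :: "nat \<Rightarrow> 'a::field skp set" where
  "skp_carrier k = {f. finite {n. f n \<noteq> 0} \<and> (\<forall>n. f n \<in> Rk_carrier k)}"

definition skp_add :: "'a::field skp \<Rightarrow> 'a skp \<Rightarrow> 'a skp" where
  "skp_add f g = (\<lambda>n. f n + g n)"

definition skp_minus :: "'a::field skp \<Rightarrow> 'a skp \<Rightarrow> 'a skp" where
  "skp_minus f g = (\<lambda>n. f n - g n)"

text \<open>x a = Theta(a) x, hence (sum f_i x^i)(sum g_j x^j) = sum f_i Theta^i(g_j) x^(i+j).\<close>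
definition skp_mult :: "nat \<Rightarrow> ('a::field poly \<Rightarrow> 'a poly) \<Rightarrow> 'a skp \<Rightarrow> 'a skp \<Rightarrow> 'a skp" where
  "skp_mult k \<Theta> f g = (\<lambda>n. \<Sum>i\<le>n. Rk_mult k (f i) ((\<Theta> ^^ i) (g (n - i))))"

definition skp_const :: "'a::field poly \<Rightarrow> 'a skp" where
  "skp_const c = (\<lambda>n. if n = 0 then c else 0)"

definition skp_X :: "'a::field skp" where
  "skp_X = (\<lambda>n. if n = 1 then 1 else 0)"

definition skp_pow :: "nat \<Rightarrow> ('a::field poly \<Rightarrow> 'a poly) \<Rightarrow> 'a skp \<Rightarrow> nat \<Rightarrow> 'a skp" where
  "skp_pow k \<Theta> f n = ((skp_mult k \<Theta> f) ^^ n) (skp_const 1)"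

definition skp_deg :: "'a::field skp \<Rightarrow> nat" where
  "skp_deg f = (LEAST d. \<forall>n\<ge>d. f n = 0) - 1"

text \<open>Skew polynomials of degree < N: the ambient space R_k^N of codewords.\<close>
definition codespace :: "nat \<Rightarrow> nat \<Rightarrow> 'a::field skp set" where
  "codespace k N = {a \<in> skp_carrier k. \<forall>n\<ge>N. a n = 0}"

text \<open>Canonical representatives of R_k[x;Theta]/<f> (f monic central).\<close>
definition quot_reps :: "nat \<Rightarrow> 'a::field skp \<Rightarrow> 'a skp set" where
  "quot_reps k f = codespace k (skp_deg f)"

definition skrem :: "nat \<Rightarrow> ('a::field poly \<Rightarrow> 'a poly) \<Rightarrow> 'a skp \<Rightarrow> 'a skp \<Rightarrow> 'a skp" where
  "skrem k \<Theta> f a = (THE r. r \<in> quot_reps k f \<and>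
      (\<exists>q\<in>skp_carrier k. a = skp_add (skp_mult k \<Theta> q f) r))"

definition left_ideal_mod :: "nat \<Rightarrow> ('a::field poly \<Rightarrow> 'a poly) \<Rightarrow> 'a skp \<Rightarrow> 'a skp set \<Rightarrow> bool" where
  "left_ideal_mod k \<Theta> f I \<longleftrightarrow> I \<subseteq> quot_reps k f \<and> (\<lambda>_. 0) \<in> I \<and>
     (\<forall>a\<in>I. \<forall>b\<in>I. skp_add a b \<in> I) \<and> (\<forall>a\<in>I. skp_minus (\<lambda>_. 0) a \<in> I) \<and>
     (\<forall>r\<in>quot_reps k f. \<forall>a\<in>I. skrem k \<Theta> f (skp_mult k \<Theta> r a) \<in> I)"

definition skew_negacyclic_code :: "nat \<Rightarrow> ('a::field poly \<Rightarrow> 'a poly) \<Rightarrow> nat \<Rightarrow> 'a skp set \<Rightarrow> bool" where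
  "skew_negacyclic_code k \<Theta> N C \<longleftrightarrow>
     left_ideal_mod k \<Theta> (skp_add (skp_pow k \<Theta> skp_X N) (skp_const 1)) C"

definition euclid_dual :: "nat \<Rightarrow> nat \<Rightarrow> 'a::field skp set \<Rightarrow> 'a skp set" where
  "euclid_dual k N C = {d \<in> codespace k N. \<forall>c\<in>C. (\<Sum>i<N. Rk_mult k (c i) (d i)) = 0}"

definition fac_lin :: "nat \<Rightarrow> ('a::field poly \<Rightarrow> 'a poly) \<Rightarrow> 'a \<Rightarrow> nat \<Rightarrow> 'a skp" where
  "fac_lin k \<Theta> c e = skp_pow k \<Theta> (skp_minus skp_X (skp_const [:c:])) e"

definition fac_quad :: "nat \<Rightarrow> ('a::field poly \<Rightarrow> 'a poly) \<Rightarrow> 'a \<Rightarrow> nat \<Rightarrow> 'a skp" where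
  "fac_quad k \<Theta> c e = skp_pow k \<Theta>
     (skp_minus (skp_add (skp_mult k \<Theta> skp_X skp_X) (skp_mult k \<Theta> (skp_const [:c:]) skp_X))
        (skp_const 1)) e"

definition alpha_of :: "'a::field \<Rightarrow> nat \<Rightarrow> 'a" where
  "alpha_of \<xi> p = \<xi> ^ ((p - 1) div 4)"

definition crt_map :: "nat \<Rightarrow> ('a::field poly \<Rightarrow> 'a poly) \<Rightarrow> 'a skp \<Rightarrow> 'a skp \<Rightarrow> 'a skp \<Rightarrow> 'a skp
    \<Rightarrow> 'a skp \<Rightarrow> 'a skp \<times> 'a skp \<times> 'a skp \<times> 'a skp" where
  "crt_map k \<Theta> g1 g2 g3 g4 a = (skrem k \<Theta> g1 a, skrem k \<Theta> g2 a, skrem k \<Theta> g3 a, skrem k \<Theta> g4 a)"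

end

theory Submission
  imports Defs "HOL-Library.Function_Algebras" "HOL-Computational_Algebra.Formal_Power_Series"
begin

text \<open>
  Write \<open>q = p ^ s\<close>. The four factors have coefficients in the prime field, which \<open>\<Theta>\<close> fixes, so they
  are images of ordinary polynomials; by the freshman's dream they are polynomials in \<open>x ^ q\<close>, hence
  central, and their product comes from \<open>y ^ 6 + 1 = (y - \<alpha>) (y + \<alpha>) (y\<^sup>2 + \<alpha> y - 1) (y\<^sup>2 - \<alpha> y - 1)\<close>,
  where \<open>\<alpha>\<^sup>2 = - 1\<close>. Bezout identities in the commutative ring \<open>F[x]\<close> then give elements
  congruent to \<open>1\<close> modulo one factor and to \<open>0\<close> modulo the others, which split every left ideal. The
  Euclidean dual is again a left ideal because the negacyclic shift permutes the code and
  transforms the inner product by \<open>\<Theta>\<close>.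
\<close>

section \<open>The skew polynomial ring\<close>

text \<open>\<open>\<Theta>\<close> is constrained only on \<open>Rk_carrier k\<close>, so
  associativity and right distributivity of \<open>skp_mult\<close> hold only on the carrier. For
  this reason carrier membership accompanies nearly every computation, and the polynomial identities
  are proved in \<open>F[x]\<close> before being transported. The condition on \<open>p\<close>
  enters in two ways: \<open>p mod 4 = 1\<close> makes \<alpha> a square root of -1, and
  \<open>p \<ge> 5\<close> makes 2 and 3 invertible, which separates the factors from one another.
  The crossed numbering of the dual components means that \<open>D1\<close> is the remainder set of
  the dual modulo \<open>f2\<close>, \<open>D2\<close> modulo \<open>f1\<close>, and likewise for
  \<open>D3\<close> and \<open>D4\<close>. Each equation in the self-duality criterion therefore
  compares \<open>C\<close> and its dual modulo one and the same factor. The criterion thus amounts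
  to a left ideal being determined by its four remainder sets.\<close>

lemma skp_add_eq: "skp_add f g = f + g"
  by (simp add: skp_add_def plus_fun_def)

lemma skp_minus_eq: "skp_minus f g = f - g"
  by (simp add: skp_minus_def fun_diff_def)

section \<open>Arithmetic of truncated polynomials\<close>

lemma Rk_mult_commute: "Rk_mult k a b = Rk_mult k b a"
  by (simp add: Rk_mult_def mult.commute)

lemma Rk_mult_assoc: "Rk_mult k (Rk_mult k a b) c = Rk_mult k a (Rk_mult k b c)"
  by (simp add: Rk_mult_def mod_mult_left_eq mod_mult_right_eq mult.assoc)

lemma Rk_mult_add_left: "Rk_mult k (a + b) c = Rk_mult k a c + Rk_mult k b c"
  by (simp add: Rk_mult_def poly_mod_add_left distrib_right)

lemma Rk_mult_add_right: "Rk_mult k a (b + c) = Rk_mult k a b + Rk_mult k a c"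
  by (simp add: Rk_mult_def poly_mod_add_left distrib_left)

lemma Rk_mult_zero [simp]: "Rk_mult k 0 a = 0" "Rk_mult k a 0 = 0"
  by (simp_all add: Rk_mult_def)

lemma Rk_mult_minus [simp]:
  "Rk_mult k (- a) b = - Rk_mult k a b" "Rk_mult k a (- b) = - Rk_mult k a b"
  by (simp_all add: Rk_mult_def poly_mod_minus_left)

lemma Rk_mult_sum_left: "Rk_mult k (sum f A) c = (\<Sum>i\<in>A. Rk_mult k (f i) c)"
  by (induction A rule: infinite_finite_induct) (simp_all add: Rk_mult_add_left)

lemma Rk_mult_sum_right: "Rk_mult k c (sum f A) = (\<Sum>i\<in>A. Rk_mult k c (f i))"
  by (induction A rule: infinite_finite_induct) (simp_all add: Rk_mult_add_right)

lemma Rk_zero [simp, intro]: "1 \<le> k \<Longrightarrow> 0 \<in> Rk_carrier k"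
  by (simp add: Rk_carrier_def)

lemma Rk_const [simp, intro]: "1 \<le> k \<Longrightarrow> [:c:] \<in> Rk_carrier k"
  by (simp add: Rk_carrier_def)

lemma Rk_add [intro]: "a \<in> Rk_carrier k \<Longrightarrow> b \<in> Rk_carrier k \<Longrightarrow> a + b \<in> Rk_carrier k"
  by (simp add: Rk_carrier_def degree_add_less)

lemma Rk_uminus [intro]: "a \<in> Rk_carrier k \<Longrightarrow> - a \<in> Rk_carrier k"
  by (simp add: Rk_carrier_def)

lemma Rk_mult_closed [intro]: "1 \<le> k \<Longrightarrow> Rk_mult k a b \<in> Rk_carrier k"
  using degree_mod_less'[of "monom 1 k :: 'a::field poly" "a * b"]
  by (cases "Rk_mult k a b = 0") (auto simp: Rk_carrier_def Rk_mult_def degree_monom_eq)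

lemma Rk_sum [intro]:
  "1 \<le> k \<Longrightarrow> (\<And>i. i \<in> A \<Longrightarrow> f i \<in> Rk_carrier k) \<Longrightarrow> sum f A \<in> Rk_carrier k"
  by (induction A rule: infinite_finite_induct) auto

lemma Rk_mult_one [simp]:
  assumes "a \<in> Rk_carrier k"
  shows "Rk_mult k 1 a = a" "Rk_mult k a 1 = a"
  using assms by (auto simp: Rk_carrier_def Rk_mult_def mod_poly_less degree_monom_eq)

lemma Rk_mult_const:
  assumes "a \<in> Rk_carrier k"
  shows "Rk_mult k [:c:] a = smult c a"
  using assms by (auto simp: Rk_carrier_def Rk_mult_def degree_monom_eq mod_poly_less
      intro!: le_less_trans[OF degree_smult_le])

locale skew_poly_ring =
  fixes k :: nat and \<Theta> :: "'a::field poly \<Rightarrow> 'a poly"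
  assumes k_pos: "1 \<le> k" and aut: "Rk_aut k \<Theta>"
begin

abbreviation R :: "'a poly set" where "R \<equiv> Rk_carrier k"
abbreviation S :: "'a skp set" where "S \<equiv> skp_carrier k"
abbreviation Rk_times (infixl "\<odot>" 70) where "a \<odot> b \<equiv> Rk_mult k a b"
abbreviation skp_times (infixl "\<star>" 70) where "f \<star> g \<equiv> skp_mult k \<Theta> f g"

lemma R_simps [simp, intro]: "0 \<in> R" "1 \<in> R" "[:c:] \<in> R" "a \<odot> b \<in> R"
  using k_pos Rk_const[of k 1] by (auto simp: one_pCons)

lemma Theta_closed [intro]: "a \<in> R \<Longrightarrow> \<Theta> a \<in> R"
  using aut by (auto simp: Rk_aut_def bij_betw_def)

lemma Theta_pow_closed [intro]: "a \<in> R \<Longrightarrow> (\<Theta> ^^ i) a \<in> R"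
  by (induction i) auto

lemma Theta_pow_one [simp]: "(\<Theta> ^^ i) 1 = 1"
  using aut by (induction i) (auto simp: Rk_aut_def)

lemma Theta_pow_add: "a \<in> R \<Longrightarrow> b \<in> R \<Longrightarrow> (\<Theta> ^^ i) (a + b) = (\<Theta> ^^ i) a + (\<Theta> ^^ i) b"
proof (induction i)
  case (Suc i)
  then show ?case using aut Theta_pow_closed[of a i] Theta_pow_closed[of b i]
    by (simp add: Rk_aut_def)
qed simp

lemma Theta_pow_mult: "a \<in> R \<Longrightarrow> b \<in> R \<Longrightarrow> (\<Theta> ^^ i) (a \<odot> b) = (\<Theta> ^^ i) a \<odot> (\<Theta> ^^ i) b"
proof (induction i)
  case (Suc i)
  then show ?case using aut Theta_pow_closed[of a i] Theta_pow_closed[of b i]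
    by (simp add: Rk_aut_def)
qed simp

lemma Theta_pow_zero [simp]: "(\<Theta> ^^ i) 0 = 0"
  using Theta_pow_add[of 0 0 i] by (simp only: add_0_left add_cancel_right_left R_simps simp_thms add_cancel_left_right)

lemma Theta_pow_uminus: "a \<in> R \<Longrightarrow> (\<Theta> ^^ i) (- a) = - (\<Theta> ^^ i) a"
  using Theta_pow_add[of a "- a" i] Rk_uminus[of a k] by (simp add: eq_neg_iff_add_eq_0 add.commute)

lemma Theta_pow_sum:
  "(\<And>j. j \<in> A \<Longrightarrow> f j \<in> R) \<Longrightarrow> (\<Theta> ^^ i) (sum f A) = (\<Sum>j\<in>A. (\<Theta> ^^ i) (f j))"
proof (induction A rule: infinite_finite_induct)
  case (insert x F)
  then show ?case using k_pos by (simp add: Theta_pow_add Rk_sum)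
qed simp_all

lemmas Theta_add = Theta_pow_add[where i = 1, simplified]
  and Theta_mult = Theta_pow_mult[where i = 1, simplified]
  and Theta_zero [simp] = Theta_pow_zero[where i = 1, simplified]
  and Theta_one [simp] = Theta_pow_one[where i = 1, simplified]
  and Theta_uminus = Theta_pow_uminus[where i = 1, simplified]
  and Theta_sum = Theta_pow_sum[where i = 1, simplified]

section \<open>Finite support and bounded length\<close>

lemma S_iff: "f \<in> S \<longleftrightarrow> (\<exists>M. \<forall>n\<ge>M. f n = 0) \<and> (\<forall>n. f n \<in> R)"
proof -
  have "finite {n. f n \<noteq> 0} \<longleftrightarrow> (\<exists>M. \<forall>n\<ge>M. f n = 0)"
    unfolding finite_nat_set_iff_bounded by (auto simp: not_less[symmetric]) 
  then show ?thesis by (simp add: skp_carrier_def)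
qed

lemma S_coeff: "f \<in> S \<Longrightarrow> f n \<in> R"
  by (simp add: S_iff)

lemma S_bound: "f \<in> S \<Longrightarrow> \<exists>M. f \<in> codespace k M"
  unfolding codespace_def using S_iff by auto

lemma codespace_S [intro]: "f \<in> codespace k M \<Longrightarrow> f \<in> S"
  by (simp add: codespace_def)

lemma codespace_iff: "f \<in> codespace k M \<longleftrightarrow> (\<forall>n. f n \<in> R) \<and> (\<forall>n\<ge>M. f n = 0)"
  by (auto simp: codespace_def S_iff)

lemma codespace_zero [simp, intro]: "(0 :: 'a skp) \<in> codespace k M"
  by (simp add: codespace_iff)

lemma codespace_add [intro]:
  fixes f g :: "'a skp"
  shows "f \<in> codespace k M \<Longrightarrow> g \<in> codespace k M \<Longrightarrow> f + g \<in> codespace k M"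
  by (auto simp: codespace_iff)

lemma codespace_uminus [intro]: "(f :: 'a skp) \<in> codespace k M \<Longrightarrow> - f \<in> codespace k M"
  by (auto simp: codespace_iff fun_Compl_def)

lemma codespace_diff [intro]:
  fixes f g :: "'a skp"
  shows "f \<in> codespace k M \<Longrightarrow> g \<in> codespace k M \<Longrightarrow> f - g \<in> codespace k M"
  using codespace_add[of f M "- g"] codespace_uminus[of g M] by simp

lemma codespace_mono: "(f :: 'a skp) \<in> codespace k M \<Longrightarrow> M \<le> M' \<Longrightarrow> f \<in> codespace k M'"
  by (auto simp: codespace_iff)

lemma S_zero [simp, intro]: "0 \<in> S"
  using codespace_zero by blast

lemma S_add [intro]: "f \<in> S \<Longrightarrow> g \<in> S \<Longrightarrow> f + g \<in> S"
  by (metis S_bound codespace_S codespace_add codespace_mono linear)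

lemma S_uminus [intro]: "f \<in> S \<Longrightarrow> - f \<in> S"
  by (metis S_bound codespace_S codespace_uminus)

lemma S_diff [intro]: "f \<in> S \<Longrightarrow> g \<in> S \<Longrightarrow> f - g \<in> S"
  using S_add[of f "- g"] S_uminus[of g] by simp

lemma codespace_mult:
  assumes "f \<in> codespace k A" "g \<in> codespace k B"
  shows "f \<star> g \<in> codespace k (A + B)"
  unfolding codespace_iff
proof (intro conjI allI impI)
  fix n
  show "(f \<star> g) n \<in> R" unfolding skp_mult_def using k_pos by blast
  assume n: "A + B \<le> n"
  have "f i = 0 \<or> g (n - i) = 0" for i
    using assms n by (cases "A \<le> i") (auto simp: codespace_iff)
  then have "f i \<odot> (\<Theta> ^^ i) (g (n - i)) = 0" for i
    by (metis Rk_mult_zero Theta_pow_zero)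
  then show "(f \<star> g) n = 0" unfolding skp_mult_def by simp
qed

lemma S_mult [intro]: "f \<in> S \<Longrightarrow> g \<in> S \<Longrightarrow> f \<star> g \<in> S"
  by (meson S_bound codespace_S codespace_mult)

lemma skp_mult_assoc:
  assumes "f \<in> S" "g \<in> S" "h \<in> S"
  shows "(f \<star> g) \<star> h = f \<star> (g \<star> h)"
proof
  fix n
  \<comment> \<open>The contribution of the powers \<open>x^i\<close>, \<open>x^j\<close>,
    \<open>x^l\<close>: moving \<open>x^i\<close> past \<open>g j\<close> twists it by
    \<open>\<Theta>^i\<close>, and \<open>h l\<close> is passed by \<open>x^(i+j)\<close>.\<close>
  define F where "F i j l = f i \<odot> ((\<Theta> ^^ i) (g j) \<odot> (\<Theta> ^^ (i + j)) (h l))" for i j l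
  have "((f \<star> g) \<star> h) n = (\<Sum>j=0..n. \<Sum>i=0..j. F i (j - i) (n - j))"
    unfolding skp_mult_def F_def
    by (simp add: Rk_mult_sum_left Rk_mult_assoc atLeast0AtMost)
  \<comment> \<open>Regrouping index triples of fixed sum is independent of the twist, so the
    summation lemma behind associativity of power series applies.\<close>
  also have "\<dots> = (\<Sum>j=0..n. \<Sum>i=0..n - j. F j i (n - j - i))"
    by (rule fps_mult_assoc_lemma)
  also have "\<dots> = (f \<star> (g \<star> h)) n"
  proof -
    have "(\<Theta> ^^ j) (\<Sum>i\<le>n-j. g i \<odot> (\<Theta> ^^ i) (h (n - j - i)))
        = (\<Sum>i\<le>n-j. (\<Theta> ^^ j) (g i) \<odot> (\<Theta> ^^ (j + i)) (h (n - j - i)))" for j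
      using S_coeff assms(2,3)
      by (subst Theta_pow_sum) (auto intro!: sum.cong simp: Theta_pow_mult Theta_pow_closed funpow_add)
    then show ?thesis
      unfolding skp_mult_def F_def by (simp add: Rk_mult_sum_right atLeast0AtMost)
  qed
  finally show "((f \<star> g) \<star> h) n = (f \<star> (g \<star> h)) n" .
qed

lemma skp_mult_add_left: "(f + g) \<star> h = f \<star> h + g \<star> h"
  by (rule ext) (simp add: skp_mult_def Rk_mult_add_left sum.distrib)

lemma skp_mult_add_right:
  assumes "g \<in> S" "h \<in> S"
  shows "f \<star> (g + h) = f \<star> g + f \<star> h"
  using S_coeff[OF assms(1)] S_coeff[OF assms(2)]
  by (intro ext) (simp add: skp_mult_def Theta_pow_add Rk_mult_add_right sum.distrib)

lemma skp_mult_uminus_left: "(- f) \<star> h = - (f \<star> h)"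
  by (rule ext) (simp add: skp_mult_def sum_negf)

lemma skp_mult_diff_left: "(f - g) \<star> h = f \<star> h - g \<star> h"
  using skp_mult_add_left[of f "- g" h] by (simp add: skp_mult_uminus_left)

lemma skp_mult_zero [simp]: "0 \<star> f = 0" "f \<star> 0 = 0"
  by (simp_all add: skp_mult_def fun_eq_iff)

lemma skp_const_S [intro]: "c \<in> R \<Longrightarrow> skp_const c \<in> S"
  by (auto simp: S_iff skp_const_def intro!: exI[of _ 1])

lemma skp_const_mult: "(skp_const c \<star> f) n = c \<odot> f n"
proof -
  have "(skp_const c \<star> f) n = (\<Sum>i\<le>n. if i = 0 then c \<odot> f n else 0)"
    unfolding skp_mult_def skp_const_def by (intro sum.cong) auto
  then show ?thesis by simp
qed

lemma skp_const_one_mult [simp]: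
  assumes "f \<in> S"
  shows "skp_const 1 \<star> f = f"
  using S_coeff[OF assms] by (intro ext) (simp add: skp_const_mult)

lemma skp_mult_const_one [simp]:
  assumes "f \<in> S"
  shows "f \<star> skp_const 1 = f"
proof
  fix n
  have "(f \<star> skp_const 1) n = (\<Sum>i\<le>n. if i = n then f n else 0)"
    unfolding skp_mult_def skp_const_def using S_coeff[OF assms] by (intro sum.cong) auto
  then show "(f \<star> skp_const 1) n = f n" by simp
qed

lemma skp_X_mult: "(skp_X \<star> f) n = (if n = 0 then 0 else \<Theta> (f (n - 1)))"
  if "f \<in> S"
proof -
  have "(skp_X \<star> f) n = (\<Sum>i\<le>n. if i = 1 then \<Theta> (f (n - 1)) else 0)"
    unfolding skp_mult_def skp_X_def using S_coeff[OF that] 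
    by (intro sum.cong) (auto simp: Theta_closed)
  then show ?thesis by simp
qed

section \<open>Division with remainder\<close>

definition monic :: "nat \<Rightarrow> 'a skp \<Rightarrow> bool" where
  "monic d f \<longleftrightarrow> f \<in> S \<and> f d = 1 \<and> (\<forall>n>d. f n = 0)"

lemma monic_S [intro]: "monic d f \<Longrightarrow> f \<in> S"
  by (simp add: monic_def)

lemma skp_deg_monic:
  assumes "monic d f"
  shows "skp_deg f = d"
proof -
  have "(LEAST d. \<forall>n\<ge>d. f n = 0) = Suc d"
  proof (rule Least_equality)
    show "\<forall>n\<ge>Suc d. f n = 0" using assms by (auto simp: monic_def)
  next
    fix y assume "\<forall>n\<ge>y. f n = 0"
    then show "Suc d \<le> y" using assms unfolding monic_def by (metis not_less_eq_eq zero_neq_one)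
  qed
  then show ?thesis by (simp add: skp_deg_def)
qed

lemma quot_reps_monic: "monic d f \<Longrightarrow> quot_reps k f = codespace k d"
  by (simp add: quot_reps_def skp_deg_monic)

text \<open>Only \<open>i = e\<close> contributes: for smaller \<open>i\<close> the index of
  \<open>f\<close> exceeds \<open>d\<close>, for larger \<open>i\<close> the coefficient of
  \<open>q\<close> vanishes. The twist is harmless because \<open>\<Theta>\<close> fixes 1.\<close>

lemma mult_monic_coeff:
  assumes "monic d f" "q \<in> codespace k (Suc e)"
  shows "(q \<star> f) (e + d) = q e"
proof -
  have "(q \<star> f) (e + d) = (\<Sum>i\<le>e+d. if i = e then q e else 0)"
    unfolding skp_mult_def
  proof (intro sum.cong refl)
    fix i assume "i \<in> {..e+d}"
    consider "i < e" | "i = e" | "i > e" by linarith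
    then show "q i \<odot> (\<Theta> ^^ i) (f (e + d - i)) = (if i = e then q e else 0)"
      by cases (use assms in \<open>auto simp: monic_def codespace_iff\<close>)
  qed
  then show ?thesis by simp
qed

text \<open>\<open>R_k\<close> may have zero divisors, so cancellation rests on \<open>f\<close>
  being monic: the top coefficient of \<open>q\<close> reappears in the product at an index of at
  least \<open>d\<close>. Uniqueness of remainders follows from this.\<close>

lemma mult_monic_codespace_eq_0:
  assumes f: "monic d f" and q: "q \<in> S" and qf: "q \<star> f \<in> codespace k d"
  shows "q = 0"
proof (rule ccontr)
  assume "q \<noteq> 0"
  then obtain n where n: "q n \<noteq> 0" by (auto simp: fun_eq_iff)
  obtain M where M: "\<And>i. q i \<noteq> 0 \<Longrightarrow> i \<le> M" using q unfolding S_iff by (metis nat_le_linear)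
  define e where "e = (GREATEST i. q i \<noteq> 0)"
  have "q e \<noteq> 0" unfolding e_def using n M by (rule GreatestI_nat)
  moreover have "q i = 0" if "i > e" for i
    using Greatest_le_nat[of "\<lambda>i. q i \<noteq> 0" i M] M that unfolding e_def by fastforce
  ultimately have "(q \<star> f) (e + d) \<noteq> 0"
    using mult_monic_coeff[OF f, of q e] q by (auto simp: codespace_iff S_iff)
  then show False using qf by (auto simp: codespace_iff)
qed

lemma monic_division:
  assumes f: "monic d f" and a: "a \<in> S"
  shows "\<exists>q\<in>S. \<exists>r\<in>codespace k d. a = q \<star> f + r"
proof -
  have "a \<in> codespace k M \<Longrightarrow> \<exists>q\<in>S. \<exists>r\<in>codespace k d. a = q \<star> f + r" for a M
  proof (induction M arbitrary: a)
    case 0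
    then have "a \<in> codespace k d" by (auto intro: codespace_mono)
    then show ?case by (metis S_zero skp_mult_zero(1) add_0)
  next
    case (Suc M)
    show ?case
    proof (cases "Suc M \<le> d")
      case True
      then have "a \<in> codespace k d" using Suc.prems by (rule codespace_mono[rotated])
      then show ?thesis by (metis S_zero skp_mult_zero(1) add_0)
    next
      case False
      define e where "e = M - d"
      \<comment> \<open>The monomial with coefficient \<open>a M\<close> and degree
        \<open>M - d\<close>, multiplied from the left, cancels the top coefficient exactly, since
        \<open>\<Theta>\<close> fixes the leading 1 of \<open>f\<close>.\<close>
      define t where "t = (\<lambda>n. if n = e then a M else 0)"
      have t: "t \<in> codespace k (Suc e)"
        using Suc.prems by (auto simp: t_def codespace_iff)
      have "f \<in> codespace k (Suc d)" using f S_iff by (auto simp: monic_def codespace_iff)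
      then have "(t \<star> f) n = 0" if "n > M" for n
      proof -
        have "t i \<odot> (\<Theta> ^^ i) (f (n - i)) = 0" for i
          using that False \<open>f \<in> codespace k (Suc d)\<close>
          by (cases "i = e") (auto simp: t_def e_def codespace_iff)
        then show ?thesis by (simp add: skp_mult_def)
      qed
      moreover have "(t \<star> f) M = a M"
        using mult_monic_coeff[OF f t] False by (simp add: e_def t_def)
      moreover have "a - t \<star> f \<in> S" using Suc.prems t f by blast
      ultimately have "a - t \<star> f \<in> codespace k M"
        using Suc.prems S_coeff[of "a - t \<star> f"]
        unfolding codespace_iff by (auto simp: Suc_le_eq le_less[of M])
      from Suc.IH[OF this] obtain q r where qr: "q \<in> S" "r \<in> codespace k d" "a - t \<star> f = q \<star> f + r"
        by blast
      then have "a = (q + t) \<star> f + r"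
        by (simp add: skp_mult_add_left algebra_simps)
      then show ?thesis using qr t by blast
    qed
  qed
  then show ?thesis using S_bound[OF a] by blast
qed

text \<open>Turns the definite description in \<open>skrem_def\<close> into a computation rule;
  uniqueness comes from \<open>mult_monic_codespace_eq_0\<close>.\<close>

lemma skrem_eqI:
  assumes f: "monic d f" and "q \<in> S" "r \<in> codespace k d" "a = q \<star> f + r"
  shows "skrem k \<Theta> f a = r"
  unfolding skrem_def quot_reps_monic[OF f] skp_add_eq
proof (rule the_equality)
  show "r \<in> codespace k d \<and> (\<exists>q\<in>S. a = q \<star> f + r)" using assms by blast
next
  fix r' assume r': "r' \<in> codespace k d \<and> (\<exists>q\<in>S. a = q \<star> f + r')"
  then obtain q' where q': "q' \<in> S" "a = q' \<star> f + r'" by blast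
  have "(q - q') \<star> f = r' - r"
    using q' assms by (simp add: skp_mult_diff_left algebra_simps)
  moreover have "r' - r \<in> codespace k d" using r' assms by blast
  ultimately have "q - q' = 0"
    using mult_monic_codespace_eq_0[OF f, of "q - q'"] q' assms(2) by auto
  then show "r' = r" using q' assms by simp
qed

lemma skrem_decomp:
  assumes "monic d f" "a \<in> S"
  shows "skrem k \<Theta> f a \<in> codespace k d \<and> (\<exists>q\<in>S. a = q \<star> f + skrem k \<Theta> f a)"
proof -
  obtain q r where "q \<in> S" "r \<in> codespace k d" "a = q \<star> f + r"
    using monic_division[OF assms] by (elim bexE) (rule that)
  moreover from this have "skrem k \<Theta> f a = r" by (rule skrem_eqI[OF assms(1)])
  ultimately show ?thesis by metis
qed

lemma skrem_closed [intro]: "monic d f \<Longrightarrow> a \<in> S \<Longrightarrow> skrem k \<Theta> f a \<in> codespace k d"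
  using skrem_decomp by (rule conjunct1)

lemma skrem_S [intro]: "monic d f \<Longrightarrow> a \<in> S \<Longrightarrow> skrem k \<Theta> f a \<in> S"
  using skrem_closed by (rule codespace_S)

lemma skrem_ident: "monic d f \<Longrightarrow> r \<in> codespace k d \<Longrightarrow> skrem k \<Theta> f r = r"
  by (rule skrem_eqI[of d f 0]) auto

lemma skrem_zero [simp]: "monic d f \<Longrightarrow> skrem k \<Theta> f 0 = 0"
  by (rule skrem_ident) auto

lemma skrem_mult_self: "monic d f \<Longrightarrow> q \<in> S \<Longrightarrow> skrem k \<Theta> f (q \<star> f) = 0"
  by (rule skrem_eqI) auto

lemma skrem_add:
  assumes "monic d f" "a \<in> S" "b \<in> S"
  shows "skrem k \<Theta> f (a + b) = skrem k \<Theta> f a + skrem k \<Theta> f b"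
proof -
  define a' where "a' = skrem k \<Theta> f a"
  define b' where "b' = skrem k \<Theta> f b"
  obtain q where q: "q \<in> S" "a = q \<star> f + a'"
    using skrem_decomp[OF assms(1,2)] unfolding a'_def[symmetric] by blast
  obtain q' where q': "q' \<in> S" "b = q' \<star> f + b'"
    using skrem_decomp[OF assms(1,3)] unfolding b'_def[symmetric] by blast
  have "a' + b' \<in> codespace k d"
    using assms a'_def b'_def by blast
  moreover have "a + b = (q + q') \<star> f + (a' + b')"
    unfolding q(2) q'(2) by (simp add: skp_mult_add_left)
  ultimately show ?thesis
    unfolding a'_def[symmetric] b'_def[symmetric] using q(1) q'(1) assms(1) by (intro skrem_eqI) auto
qed

lemma skrem_uminus:
  assumes "monic d f" "a \<in> S"
  shows "skrem k \<Theta> f (- a) = - skrem k \<Theta> f a"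
proof -
  have "skrem k \<Theta> f a + skrem k \<Theta> f (- a) = 0"
    using skrem_add[OF assms S_uminus[OF assms(2)]] skrem_zero[OF assms(1)] by simp
  then show ?thesis by (rule minus_unique[symmetric])
qed

lemma skrem_sum:
  assumes "monic d f" "\<And>i. i \<in> A \<Longrightarrow> a i \<in> S"
  shows "skrem k \<Theta> f (sum a A) = (\<Sum>i\<in>A. skrem k \<Theta> f (a i))"
proof -
  have "sum a A \<in> S \<and> ?thesis" using assms(2)
    by (induction A rule: infinite_finite_induct) (use assms(1) in \<open>auto simp: skrem_add\<close>)
  then show ?thesis ..
qed

lemma skrem_add_multiple:
  assumes "monic d f" "q \<in> S" "a \<in> S"
  shows "skrem k \<Theta> f (q \<star> f + a) = skrem k \<Theta> f a"
  using skrem_add[OF assms(1) S_mult[OF assms(2) monic_S[OF assms(1)]] assms(3)]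
  by (simp add: skrem_mult_self[OF assms(1,2)])

text \<open>Remainders are taken modulo the left ideal generated by \<open>f\<close>, which absorbs
  left factors, so reducing before or after a left multiplication makes no difference.\<close>

lemma skrem_mult_skrem:
  assumes "monic d f" "r \<in> S" "a \<in> S"
  shows "skrem k \<Theta> f (r \<star> skrem k \<Theta> f a) = skrem k \<Theta> f (r \<star> a)"
proof -
  define a' where "a' = skrem k \<Theta> f a"
  obtain q where q: "q \<in> S" "a = q \<star> f + a'"
    using skrem_decomp[OF assms(1,3)] unfolding a'_def[symmetric] by blast
  have f: "f \<in> S" and a': "a' \<in> S" using assms a'_def by blast+
  have "r \<star> a = (r \<star> q) \<star> f + r \<star> a'"
    unfolding q(2) using q(1) f a' assms(2) by (simp add: skp_mult_add_right skp_mult_assoc S_mult)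
  then show ?thesis unfolding a'_def[symmetric]
    using assms q(1) a' by (simp add: skrem_add_multiple S_mult)
qed

text \<open>Left multiples of \<open>g \<star> f\<close> are left multiples of \<open>f\<close>, so
  a prior reduction modulo the product is invisible modulo \<open>f\<close>.\<close>

lemma skrem_skrem_mult:
  assumes "monic d f" "monic N (g \<star> f)" "g \<in> S" "a \<in> S"
  shows "skrem k \<Theta> f (skrem k \<Theta> (g \<star> f) a) = skrem k \<Theta> f a"
proof -
  define a' where "a' = skrem k \<Theta> (g \<star> f) a"
  obtain q where q: "q \<in> S" "a = q \<star> (g \<star> f) + a'"
    using skrem_decomp[OF assms(2,4)] unfolding a'_def[symmetric]
    by (elim conjE bexE) (rule that)
  have "a' \<in> S" unfolding a'_def using assms(2,4) by (rule skrem_S)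
  moreover have "a = (q \<star> g) \<star> f + a'"
    unfolding q(2) using q(1) assms by (simp add: skp_mult_assoc monic_S)
  ultimately show ?thesis unfolding a'_def[symmetric]
    using skrem_add_multiple[OF assms(1) S_mult[OF q(1) assms(3)]] by simp
qed

end

section \<open>Bezout relations in commutative rings\<close>

definition comaximal :: "'a::comm_ring_1 \<Rightarrow> 'a \<Rightarrow> bool" where
  "comaximal f g \<longleftrightarrow> (\<exists>u v. u * f + v * g = 1)"

lemma comaximalI: "u * f + v * g = 1 \<Longrightarrow> comaximal f g"
  unfolding comaximal_def by blast

lemma comaximal_commute: "comaximal f g \<longleftrightarrow> comaximal g f"
  unfolding comaximal_def by (metis add.commute)

lemma comaximal_one [simp]: "comaximal f 1"
  by (rule comaximalI[of 0 _ 1]) simp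

text \<open>Multiply the two Bezout identities: every term except the one with \<open>g * h\<close>
  is divisible by \<open>f\<close>.\<close>

lemma comaximal_mult_right:
  assumes "comaximal f g" "comaximal f h"
  shows "comaximal f (g * h)"
proof -
  obtain u v u' v' where uv: "u * f + v * g = 1" "u' * f + v' * h = 1"
    using assms unfolding comaximal_def by blast
  have "(u * u' * f + u * v' * h + v * g * u') * f + (v * v') * (g * h)
      = (u * f + v * g) * (u' * f + v' * h)"
    by (simp add: algebra_simps)
  then show ?thesis unfolding uv by (intro comaximalI) simp
qed

lemma comaximal_prod_right:
  "(\<And>i. i \<in> A \<Longrightarrow> comaximal f (g i)) \<Longrightarrow> comaximal f (prod g A)"
  by (induction A rule: infinite_finite_induct) (simp_all add: comaximal_mult_right)

lemma comaximal_power_right: "comaximal f g \<Longrightarrow> comaximal f (g ^ n)"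
  by (induction n) (simp_all add: comaximal_mult_right)

lemma comaximal_power: "comaximal f g \<Longrightarrow> comaximal (f ^ n) (g ^ n)"
  by (metis comaximal_commute comaximal_power_right)

text \<open>Modulo \<open>x - c\<close> the polynomial \<open>g\<close> becomes the constant
  \<open>poly g c\<close>, a unit of the field.\<close>

lemma comaximal_linear:
  fixes c :: "'a::field"
  assumes "poly g c \<noteq> 0"
  shows "comaximal [:- c, 1:] g"
proof (rule comaximalI)
  define s X i where "s = synthetic_div g c" and "X = [:- c, 1:]" and "i = inverse (poly g c)"
  have "g = [:poly g c:] + X * s"
    using synthetic_div_correct'[of c g] by (simp add: s_def X_def add.commute)
  then have "g - X * s = [:poly g c:]" by (metis add_diff_cancel_right')
  moreover have "smult i (- s) * X + [:i:] * g = smult i (g - X * s)"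
    by (simp add: smult_diff_right mult.commute)
  ultimately show "smult i (- s) * [:- c, 1:] + [:i:] * g = 1"
    using assms by (simp add: i_def X_def[symmetric] one_pCons)
qed

text \<open>The bridge from the commutative ring \<open>F[x]\<close>: coefficients become constants
  of \<open>R_k\<close>. It is additive; multiplicativity is available for right factors whose
  coefficients \<open>\<Theta>\<close> fixes.\<close>

definition emb :: "'a::field poly \<Rightarrow> 'a skp" where
  "emb q = (\<lambda>n. [:coeff q n:])"

lemma emb_add: "emb (p + q) = emb p + emb q"
  by (simp add: emb_def fun_eq_iff)

lemma emb_diff: "emb (p - q) = emb p - emb q"
  by (simp add: emb_def fun_eq_iff)

lemma skp_const_eq_emb: "skp_const [:c:] = emb [:c:]"
  by (auto simp: emb_def skp_const_def fun_eq_iff coeff_pCons split: nat.split)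

lemma skp_const_one_eq_emb: "skp_const 1 = emb 1"
  using skp_const_eq_emb[of 1] by (simp add: one_pCons)

lemma skp_X_eq_emb: "skp_X = emb [:0, 1:]"
  by (auto simp: emb_def skp_X_def fun_eq_iff one_pCons coeff_pCons split: nat.split)

lemma const_poly_sum: "[:sum f A:] = (\<Sum>i\<in>A. [:f i:])"
  by (rule poly_eqI) (auto simp: coeff_sum coeff_pCons split: nat.split)

section \<open>Skew polynomials with coefficients in the base field\<close>

context skew_poly_ring
begin

lemma emb_codespace: "degree (q :: 'a poly) < M \<Longrightarrow> emb q \<in> codespace k M"
  using k_pos by (auto simp: codespace_iff emb_def coeff_eq_0)

lemma emb_S [simp, intro]: "emb q \<in> S"
  using emb_codespace[of q "Suc (degree q)"] by (auto intro: codespace_S)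

lemma monic_emb: "lead_coeff q = 1 \<Longrightarrow> monic (degree q) (emb q)"
  using emb_S by (auto simp: monic_def emb_def coeff_eq_0 one_pCons)

lemma Theta_const_add:
  "\<Theta> [:a:] = [:a:] \<Longrightarrow> \<Theta> [:b:] = [:b:] \<Longrightarrow> \<Theta> [:a + b:] = [:a + b:]"
  using Theta_add[of "[:a:]" "[:b:]"] by simp

lemma Theta_const_mult:
  "\<Theta> [:a:] = [:a:] \<Longrightarrow> \<Theta> [:b:] = [:b:] \<Longrightarrow> \<Theta> [:a * b:] = [:a * b:]"
  using Theta_mult[of "[:a:]" "[:b:]"] by (simp add: Rk_mult_const)

lemma Theta_const_sum:
  "(\<And>i. i \<in> A \<Longrightarrow> \<Theta> [:f i:] = [:f i:]) \<Longrightarrow> \<Theta> [:sum f A:] = [:sum f A:]"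
  using Theta_sum[of A "\<lambda>i. [:f i:]"] by (simp add: const_poly_sum)

text \<open>\<open>\<Theta>\<close> fixes 1 and hence every sum of ones; this covers the prime
  field.\<close>

lemma Theta_const_of_nat: "\<Theta> [:of_nat n:] = [:of_nat n:]"
  by (induction n) (auto intro: Theta_const_add simp flip: one_pCons)

definition fixed_poly :: "'a poly \<Rightarrow> bool" where
  "fixed_poly q \<longleftrightarrow> (\<forall>n. \<Theta> [:coeff q n:] = [:coeff q n:])"

text \<open>A sufficient criterion for centrality: coefficients fixed by \<open>\<Theta>\<close>
  commute with \<open>x\<close>, and an exponent \<open>n\<close> with \<open>\<Theta>^n\<close>
  trivial makes \<open>x^n\<close> commute with \<open>R_k\<close>.\<close>

definition central_poly :: "'a poly \<Rightarrow> bool" where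
  "central_poly q \<longleftrightarrow> fixed_poly q \<and> (\<forall>n. coeff q n \<noteq> 0 \<longrightarrow> (\<forall>a\<in>R. (\<Theta> ^^ n) a = a))"

lemma fixed_poly_mult: "fixed_poly p \<Longrightarrow> fixed_poly q \<Longrightarrow> fixed_poly (p * q)"
  by (auto simp: fixed_poly_def coeff_mult intro!: Theta_const_sum Theta_const_mult)

lemma fixed_poly_pCons: "\<Theta> [:c:] = [:c:] \<Longrightarrow> fixed_poly q \<Longrightarrow> fixed_poly (pCons c q)"
  by (auto simp: fixed_poly_def coeff_pCons split: nat.split)

lemma fixed_poly_zero [simp]: "fixed_poly 0"
  by (simp add: fixed_poly_def)

lemma fixed_poly_one [simp]: "fixed_poly 1"
  using fixed_poly_pCons[of 1 0] by (simp add: one_pCons[symmetric])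

lemma fixed_poly_power: "fixed_poly p \<Longrightarrow> fixed_poly (p ^ n)"
  by (induction n) (auto intro: fixed_poly_mult)

lemma central_poly_one [simp]: "central_poly 1"
  by (simp add: central_poly_def coeff_1)

text \<open>An exponent in the support of a product is a sum of exponents from the two supports, and
  the exponents at which \<open>\<Theta>\<close> acts trivially are closed under addition.\<close>

lemma central_poly_mult:
  assumes "central_poly p" "central_poly q"
  shows "central_poly (p * q)"
  unfolding central_poly_def
proof (intro conjI allI impI ballI)
  show "fixed_poly (p * q)" using assms fixed_poly_mult by (simp add: central_poly_def)
next
  fix n a assume n: "coeff (p * q) n \<noteq> 0" and a: "a \<in> R"
  then obtain i where i: "i \<le> n" "coeff p i * coeff q (n - i) \<noteq> 0"
    unfolding coeff_mult by (metis (no_types, lifting) atMost_iff sum.neutral)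
  have "(\<Theta> ^^ (i + (n - i))) a = a"
    using assms i a unfolding funpow_add central_poly_def by simp
  then show "(\<Theta> ^^ n) a = a" using i by simp
qed

lemma central_poly_prod: "(\<And>i. i \<in> A \<Longrightarrow> central_poly (g i)) \<Longrightarrow> central_poly (prod g A)"
  by (induction A rule: infinite_finite_induct) (simp_all add: central_poly_mult)

text \<open>Multiplication twists only the coefficients of the right factor, whence the one-sided
  hypothesis.\<close>

lemma emb_mult:
  assumes "fixed_poly q"
  shows "emb (p * q) = emb p \<star> emb q"
proof
  fix n
  have "(\<Theta> ^^ i) [:coeff q j:] = [:coeff q j:]" for i j
    using assms by (induction i) (auto simp: fixed_poly_def)
  then show "emb (p * q) n = (emb p \<star> emb q) n"
    by (simp add: emb_def skp_mult_def coeff_mult const_poly_sum Rk_mult_const)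
qed

lemma emb_power: "fixed_poly q \<Longrightarrow> skp_pow k \<Theta> (emb q) n = emb (q ^ n)"
  by (induction n) (simp_all add: skp_pow_def skp_const_one_eq_emb emb_mult fixed_poly_power)

lemma emb_central:
  assumes "central_poly q" "g \<in> S"
  shows "emb q \<star> g = g \<star> emb q"
proof
  fix n
  have fixed: "(\<Theta> ^^ i) [:coeff q j:] = [:coeff q j:]" for i j
    using assms by (induction i) (auto simp: central_poly_def fixed_poly_def)
  have "[:coeff q i:] \<odot> (\<Theta> ^^ i) (g j) = [:coeff q i:] \<odot> g j" for i j
    using assms S_coeff[OF assms(2)] by (cases "coeff q i = 0") (auto simp: central_poly_def)
  then have "(emb q \<star> g) n = (\<Sum>i\<le>n. [:coeff q i:] \<odot> g (n - i))"
    by (simp add: skp_mult_def emb_def)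
  also have "\<dots> = (\<Sum>i\<le>n. g i \<odot> [:coeff q (n - i):])"
    by (rule sum.reindex_bij_witness[of _ "\<lambda>i. n - i" "\<lambda>i. n - i"]) (auto simp: Rk_mult_commute)
  also have "\<dots> = (g \<star> emb q) n"
    by (simp add: skp_mult_def emb_def fixed)
  finally show "(emb q \<star> g) n = (g \<star> emb q) n" .
qed

section \<open>Left ideals of the quotient rings\<close>

lemma left_ideal_mod_iff:
  assumes "monic d f"
  shows "left_ideal_mod k \<Theta> f I \<longleftrightarrow> I \<subseteq> codespace k d \<and> 0 \<in> I \<and> (\<forall>a\<in>I. \<forall>b\<in>I. a + b \<in> I) \<and>
    (\<forall>a\<in>I. - a \<in> I) \<and> (\<forall>r\<in>codespace k d. \<forall>a\<in>I. skrem k \<Theta> f (r \<star> a) \<in> I)"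
  using quot_reps_monic[OF assms]
  by (simp add: left_ideal_mod_def skp_add_eq skp_minus_eq zero_fun_def[symmetric])

lemma left_ideal_mod_codespace:
  "monic d f \<Longrightarrow> left_ideal_mod k \<Theta> f (codespace k d)"
  unfolding left_ideal_mod_iff by (auto intro!: skrem_closed S_mult)

lemma left_ideal_mod_sum:
  assumes "monic d f" "left_ideal_mod k \<Theta> f I" "\<And>i. i \<in> A \<Longrightarrow> c i \<in> I"
  shows "sum c A \<in> I"
  using assms(2,3) unfolding left_ideal_mod_iff[OF assms(1)]
  by (induction A rule: infinite_finite_induct) auto

text \<open>The definition of a left ideal lets multipliers range over representatives only. For a
  general \<open>r\<close>, centrality moves \<open>emb q\<close> to the right of \<open>a\<close>,
  where it disappears in the remainder.\<close>

lemma left_ideal_mod_absorb: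
  assumes f: "monic (degree q) (emb q)" and q: "central_poly q"
    and I: "left_ideal_mod k \<Theta> (emb q) I" and r: "r \<in> S" and a: "a \<in> I"
  shows "skrem k \<Theta> (emb q) (r \<star> a) \<in> I"
proof -
  obtain t r' where t: "t \<in> S" "r' \<in> codespace k (degree q)" "r = t \<star> emb q + r'"
    using monic_division[OF f r] by (elim bexE) (rule that)
  have aS: "a \<in> S" using I a unfolding left_ideal_mod_iff[OF f] by (meson codespace_S subsetD)
  have r'S: "r' \<in> S" using t(2) by (rule codespace_S)
  have "r \<star> a = (t \<star> a) \<star> emb q + r' \<star> a"
    unfolding t(3) using t(1) aS by (simp add: skp_mult_add_left skp_mult_assoc emb_central[OF q])
  then have "skrem k \<Theta> (emb q) (r \<star> a) = skrem k \<Theta> (emb q) (r' \<star> a)"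
    using skrem_add_multiple[OF f S_mult[OF t(1) aS] S_mult[OF r'S aS]] by simp
  then show ?thesis using I t(2) a unfolding left_ideal_mod_iff[OF f] by simp
qed

text \<open>Multiply in the larger quotient, where \<open>I\<close> is closed, and reduce
  afterwards; \<open>skrem_mult_skrem\<close> and \<open>skrem_skrem_mult\<close> show that this
  agrees with multiplying in the smaller one.\<close>

lemma left_ideal_mod_image:
  assumes f: "monic d f" and F: "monic (degree q) (emb q)" "central_poly q"
    and g: "g \<in> S" "emb q = g \<star> f" and I: "left_ideal_mod k \<Theta> (emb q) I"
  shows "left_ideal_mod k \<Theta> f (skrem k \<Theta> f ` I)"
proof -
  note I' = I[unfolded left_ideal_mod_iff[OF F(1)]]
  have IS: "a \<in> S" if "a \<in> I" for a using I' that by (meson codespace_S subsetD)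
  have mult: "skrem k \<Theta> f (r \<star> skrem k \<Theta> f a) \<in> skrem k \<Theta> f ` I"
    if "r \<in> codespace k d" "a \<in> I" for r a :: "'a skp"
  proof (rule image_eqI)
    have r: "r \<in> S" using that(1) by (rule codespace_S)
    show "skrem k \<Theta> (emb q) (r \<star> a) \<in> I"
      using left_ideal_mod_absorb[OF F I r that(2)] .
    show "skrem k \<Theta> f (r \<star> skrem k \<Theta> f a) = skrem k \<Theta> f (skrem k \<Theta> (emb q) (r \<star> a))"
      using skrem_mult_skrem[OF f r IS[OF that(2)]]
        skrem_skrem_mult[OF f _ g(1) S_mult[OF r IS[OF that(2)]]] F(1)
      unfolding g(2) by simp
  qed
  show ?thesis unfolding left_ideal_mod_iff[OF f]
  proof (intro conjI ballI)
    show "skrem k \<Theta> f ` I \<subseteq> codespace k d" using IS skrem_closed[OF f] by blast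
    show "0 \<in> skrem k \<Theta> f ` I"
      using skrem_zero[OF f] I' by (intro image_eqI[of _ _ 0]) simp_all
  next
    fix x y assume "x \<in> skrem k \<Theta> f ` I" "y \<in> skrem k \<Theta> f ` I"
    then obtain a b where ab: "a \<in> I" "b \<in> I" "x = skrem k \<Theta> f a" "y = skrem k \<Theta> f b"
      by (elim imageE) (rule that)
    then show "x + y \<in> skrem k \<Theta> f ` I"
      using skrem_add[OF f IS IS, of a b] I' by (intro image_eqI[of _ _ "a + b"]) simp_all
  next
    fix x assume "x \<in> skrem k \<Theta> f ` I"
    then obtain a where a: "a \<in> I" "x = skrem k \<Theta> f a" by (elim imageE) (rule that)
    then show "- x \<in> skrem k \<Theta> f ` I"
      using skrem_uminus[OF f IS, of a] I' by (intro image_eqI[of _ _ "- a"]) simp_all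
  next
    fix r x :: "'a skp" assume r: "r \<in> codespace k d" and "x \<in> skrem k \<Theta> f ` I"
    then obtain a where "a \<in> I" "x = skrem k \<Theta> f a" by (elim imageE) (rule that)
    then show "skrem k \<Theta> f (r \<star> x) \<in> skrem k \<Theta> f ` I" using mult[OF r] by simp
  qed
qed

text \<open>Write \<open>a = (u f + v g) a\<close> and substitute in each summand the representation
  of \<open>a\<close> through the other factor; centrality then collects \<open>f g\<close> on the
  right.\<close>

lemma common_multiple:
  assumes "comaximal f g" "central_poly f" "central_poly g" "a \<in> S" "q \<in> S" "q' \<in> S"
    and a: "a = q \<star> emb f" "a = q' \<star> emb g"
  shows "\<exists>t\<in>S. a = t \<star> emb (f * g)"
proof -
  obtain u v where "u * f + v * g = 1" using assms(1) unfolding comaximal_def by blast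
  then have uv: "emb u \<star> emb f + emb v \<star> emb g = skp_const 1"
    using assms(2,3)
    by (simp add: emb_mult[symmetric] central_poly_def emb_add[symmetric] skp_const_one_eq_emb)
  have fg: "emb f \<star> emb g = emb (f * g)" "emb g \<star> emb f = emb (f * g)"
    using assms(2,3) emb_mult[of g f] emb_mult[of f g] by (simp_all add: central_poly_def mult.commute)
  have "emb u \<star> emb f \<star> a = emb u \<star> (emb f \<star> q') \<star> emb g"
    unfolding a(2) using assms(6) by (simp add: skp_mult_assoc S_mult)
  also have "\<dots> = emb u \<star> q' \<star> emb (f * g)"
    unfolding fg(1)[symmetric] emb_central[OF assms(2,6)] using assms(6)
    by (simp add: skp_mult_assoc S_mult)
  finally have 1: "emb u \<star> emb f \<star> a = emb u \<star> q' \<star> emb (f * g)" .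
  have "emb v \<star> emb g \<star> a = emb v \<star> (emb g \<star> q) \<star> emb f"
    unfolding a(1) using assms(5) by (simp add: skp_mult_assoc S_mult)
  also have "\<dots> = emb v \<star> q \<star> emb (f * g)"
    unfolding fg(2)[symmetric] emb_central[OF assms(3,5)] using assms(5)
    by (simp add: skp_mult_assoc S_mult)
  finally have "emb v \<star> emb g \<star> a = emb v \<star> q \<star> emb (f * g)" .
  with 1 have "(emb u \<star> q' + emb v \<star> q) \<star> emb (f * g)
      = (emb u \<star> emb f + emb v \<star> emb g) \<star> a"
    by (simp add: skp_mult_add_left)
  then have "a = (emb u \<star> q' + emb v \<star> q) \<star> emb (f * g)"
    unfolding uv skp_const_one_mult[OF assms(4)] by (rule sym)
  then show ?thesis by (intro bexI[where x = "emb u \<star> q' + emb v \<star> q"] S_add S_mult emb_S assms)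
qed

end

section \<open>Chinese remaindering\<close>

text \<open>Monic for division with remainder, central so that left multiples form two-sided ideals,
  comaximal for Bezout cofactors.\<close>

locale crt_family = skew_poly_ring k \<Theta> for k :: nat and \<Theta> :: "'a::field poly \<Rightarrow> 'a poly" +
  fixes A :: "'i set" and g :: "'i \<Rightarrow> 'a poly"
  assumes finite_A: "finite A"
    and central: "i \<in> A \<Longrightarrow> central_poly (g i)"
    and lead: "i \<in> A \<Longrightarrow> lead_coeff (g i) = 1"
    and comax: "i \<in> A \<Longrightarrow> j \<in> A \<Longrightarrow> i \<noteq> j \<Longrightarrow> comaximal (g i) (g j)"
begin

definition P :: "'a poly" where "P = prod g A"

lemma monic_g: "i \<in> A \<Longrightarrow> monic (degree (g i)) (emb (g i))"
  by (rule monic_emb[OF lead])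

lemma monic_P: "monic (degree P) (emb P)"
proof (rule monic_emb)
  have "lead_coeff (prod g A) = (\<Prod>i\<in>A. lead_coeff (g i))" by (rule lead_coeff_prod)
  then show "lead_coeff P = 1" using lead by (simp add: P_def)
qed

lemma central_P: "central_poly P"
  unfolding P_def by (rule central_poly_prod[OF central])

lemma emb_P_factor:
  assumes "i \<in> A"
  shows "emb P = emb (prod g (A - {i})) \<star> emb (g i)"
proof -
  have "P = prod g (A - {i}) * g i"
    unfolding P_def using finite_A assms by (simp add: prod.remove mult.commute)
  then show ?thesis using emb_mult central[OF assms] by (simp add: central_poly_def)
qed

lemma left_ideal_component:
  assumes "left_ideal_mod k \<Theta> (emb P) I" "i \<in> A"
  shows "left_ideal_mod k \<Theta> (emb (g i)) (skrem k \<Theta> (emb (g i)) ` I)"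
  using left_ideal_mod_image[OF monic_g[OF assms(2)] monic_P central_P emb_S emb_P_factor[OF assms(2)] assms(1)] .

text \<open>The factors are accumulated one at a time by \<open>common_multiple\<close>, so
  \<open>a\<close> is a left multiple of \<open>P\<close>; being shorter than \<open>P\<close>, it
  vanishes.\<close>

lemma skrem_inj:
  assumes "a \<in> codespace k (degree P)" "\<And>i. i \<in> A \<Longrightarrow> skrem k \<Theta> (emb (g i)) a = 0"
  shows "a = 0"
proof -
  have aS: "a \<in> S" using assms(1) by (rule codespace_S)
  have "B \<subseteq> A \<Longrightarrow> \<exists>t\<in>S. a = t \<star> emb (prod g B)" if "finite B" for B
    using that
  proof (induction B rule: finite_induct)
    case empty
    then show ?case using aS by (simp add: skp_const_one_eq_emb[symmetric])
  next
    case (insert i B)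
    then obtain t where t: "t \<in> S" "a = t \<star> emb (prod g B)" by auto
    have i: "i \<in> A" using insert by simp
    obtain t' where t': "t' \<in> S" "a = t' \<star> emb (g i)"
      using skrem_decomp[OF monic_g[OF i] aS] assms(2)[OF i] by auto
    have "comaximal (g i) (prod g B)" using insert by (intro comaximal_prod_right comax) auto
    moreover have "central_poly (prod g B)" using insert by (intro central_poly_prod central) auto
    ultimately have "\<exists>t\<in>S. a = t \<star> emb (g i * prod g B)"
      using common_multiple[OF _ central[OF i] _ aS t'(1) t(1) t'(2) t(2)] by simp
    then show ?case using insert by simp
  qed
  from this[OF finite_A] obtain t where t: "t \<in> S" "a = t \<star> emb P" unfolding P_def by auto
  then show ?thesis using mult_monic_codespace_eq_0[OF monic_P t(1)] assms(1) by simp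
qed

text \<open>In the Bezout identity between \<open>g i\<close> and the product of the other factors,
  take the summand containing that product; it represents an idempotent modulo
  \<open>P\<close>.\<close>

lemma ex_idempotent:
  assumes "i \<in> A"
  shows "\<exists>e\<in>S. (\<exists>v\<in>S. e = v \<star> emb (g i) + skp_const 1) \<and>
           (\<forall>j\<in>A. j \<noteq> i \<longrightarrow> (\<exists>w\<in>S. e = w \<star> emb (g j)))"
proof -
  have "comaximal (g i) (prod g (A - {i}))" using assms by (intro comaximal_prod_right comax) auto
  then obtain u v where uv: "u * g i + v * prod g (A - {i}) = 1" unfolding comaximal_def by blast
  define e where "e = v * prod g (A - {i})"
  have "e = - u * g i + 1" using uv by (simp add: e_def algebra_simps)
  then have "emb e = emb (- u) \<star> emb (g i) + skp_const 1"
    using central[OF assms] by (simp add: emb_add emb_mult central_poly_def skp_const_one_eq_emb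
        del: mult_minus_left)
  moreover have "\<exists>w\<in>S. emb e = w \<star> emb (g j)" if "j \<in> A" "j \<noteq> i" for j
  proof -
    have "e = (v * prod g (A - {i} - {j})) * g j"
      unfolding e_def using that finite_A by (simp add: prod.remove[of "A - {i}" j] mult_ac)
    then show ?thesis using central[OF that(1)] emb_mult by (auto simp: central_poly_def)
  qed
  ultimately show ?thesis by blast
qed

text \<open>The point is that the solution stays in \<open>I\<close>: each \<open>c i\<close> is
  multiplied from the left by its idempotent, which a left ideal absorbs. Hence the components of
  elements of \<open>I\<close> can be chosen independently.\<close>

lemma chinese_remainder:
  assumes I: "left_ideal_mod k \<Theta> (emb P) I" and c: "\<And>i. i \<in> A \<Longrightarrow> c i \<in> I"
  shows "\<exists>a\<in>I. \<forall>j\<in>A. skrem k \<Theta> (emb (g j)) a = skrem k \<Theta> (emb (g j)) (c j)"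
proof -
  have "\<forall>i\<in>A. \<exists>e. e \<in> S \<and> (\<exists>v\<in>S. e = v \<star> emb (g i) + skp_const 1) \<and>
           (\<forall>j\<in>A. j \<noteq> i \<longrightarrow> (\<exists>w\<in>S. e = w \<star> emb (g j)))"
    using ex_idempotent by blast
  from bchoice[OF this] obtain e where
    e: "\<And>i. i \<in> A \<Longrightarrow> e i \<in> S"
       "\<And>i. i \<in> A \<Longrightarrow> \<exists>v\<in>S. e i = v \<star> emb (g i) + skp_const 1"
       "\<And>i j. i \<in> A \<Longrightarrow> j \<in> A \<Longrightarrow> j \<noteq> i \<Longrightarrow> \<exists>w\<in>S. e i = w \<star> emb (g j)"
    by blast
  have cS: "c i \<in> S" if "i \<in> A" for i
    using c[OF that] I unfolding left_ideal_mod_iff[OF monic_P] by (meson codespace_S subsetD)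
  define b where "b i = skrem k \<Theta> (emb P) (e i \<star> c i)" for i
  have bI: "b i \<in> I" if "i \<in> A" for i
    unfolding b_def using left_ideal_mod_absorb[OF monic_P central_P I e(1) c] that by blast
  have bS: "b i \<in> S" if "i \<in> A" for i
    unfolding b_def using monic_P S_mult[OF e(1) cS] that by (intro skrem_S) auto
  have bj: "skrem k \<Theta> (emb (g j)) (b i) = skrem k \<Theta> (emb (g j)) (e i \<star> c i)"
    if "i \<in> A" "j \<in> A" for i j
    using skrem_skrem_mult[OF monic_g[OF that(2)] _ emb_S S_mult[OF e(1) cS]] monic_P
      emb_P_factor[OF that(2)] that unfolding b_def by simp
  have ne: "skrem k \<Theta> (emb (g j)) (b i) = 0" if ij: "i \<in> A" "j \<in> A" "j \<noteq> i" for i j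
  proof -
    obtain w where w: "w \<in> S" "e i = w \<star> emb (g j)" using e(3)[OF ij] by (elim bexE) (rule that)
    \<comment> \<open>Centrality carries \<open>emb (g j)\<close> past \<open>c i\<close> to the
      right, where the remainder kills it.\<close>
    have "e i \<star> c i = (w \<star> c i) \<star> emb (g j)"
      using w cS[OF ij(1)] emb_central[OF central[OF ij(2)]] by (simp add: skp_mult_assoc)
    then show ?thesis
      unfolding bj[OF ij(1,2)] using skrem_mult_self[OF monic_g[OF ij(2)] S_mult[OF w(1) cS[OF ij(1)]]]
      by simp
  qed
  have eq: "skrem k \<Theta> (emb (g i)) (b i) = skrem k \<Theta> (emb (g i)) (c i)" if i: "i \<in> A" for i
  proof -
    obtain v where v: "v \<in> S" "e i = v \<star> emb (g i) + skp_const 1"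
      using e(2)[OF i] by (elim bexE) (rule that)
    have "e i \<star> c i = (v \<star> c i) \<star> emb (g i) + c i"
      using v cS[OF i] emb_central[OF central[OF i]] by (simp add: skp_mult_assoc skp_mult_add_left)
    then show ?thesis
      unfolding bj[OF i i] using skrem_add_multiple[OF monic_g[OF i] S_mult[OF v(1) cS[OF i]] cS[OF i]]
      by simp
  qed
  have "skrem k \<Theta> (emb (g j)) (sum b A) = skrem k \<Theta> (emb (g j)) (c j)" if j: "j \<in> A" for j
  proof -
    have "skrem k \<Theta> (emb (g j)) (sum b A) = (\<Sum>i\<in>A. skrem k \<Theta> (emb (g j)) (b i))"
      by (rule skrem_sum[OF monic_g[OF j] bS])
    also have "\<dots> = (\<Sum>i\<in>A. if i = j then skrem k \<Theta> (emb (g j)) (c j) else 0)"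
      using ne eq j by (intro sum.cong) auto
    finally show ?thesis using finite_A j by simp
  qed
  then show ?thesis by (intro bexI[where x = "sum b A"] left_ideal_mod_sum[OF monic_P I bI] ballI)
qed

lemma skrem_components_inj:
  assumes "a \<in> codespace k (degree P)" "b \<in> codespace k (degree P)"
    and "\<And>i. i \<in> A \<Longrightarrow> skrem k \<Theta> (emb (g i)) a = skrem k \<Theta> (emb (g i)) b"
  shows "a = b"
proof -
  have aS: "a \<in> S" and bS: "b \<in> S" using assms(1,2) by (auto intro: codespace_S)
  have "skrem k \<Theta> (emb (g i)) (a + (- b)) = 0" if i: "i \<in> A" for i
    unfolding skrem_add[OF monic_g[OF i] aS S_uminus[OF bS]] skrem_uminus[OF monic_g[OF i] bS]
    using assms(3)[OF i] by simp
  then have "a + (- b) = 0"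
    by (rule skrem_inj[OF codespace_add[OF assms(1) codespace_uminus[OF assms(2)]]])
  then show ?thesis by simp
qed

text \<open>A short polynomial is its own remainder, and it lies in the larger space because
  \<open>g i\<close> divides \<open>P\<close>.\<close>

lemma skrem_image_codespace:
  assumes "i \<in> A"
  shows "skrem k \<Theta> (emb (g i)) ` codespace k (degree P) = codespace k (degree (g i))"
proof (intro subset_antisym subsetI)
  fix x assume "x \<in> skrem k \<Theta> (emb (g i)) ` codespace k (degree P)"
  then show "x \<in> codespace k (degree (g i))"
    by (elim imageE) (simp add: skrem_closed[OF monic_g[OF assms] codespace_S])
next
  fix x :: "'a skp" assume x: "x \<in> codespace k (degree (g i))"
  have "g i dvd P" unfolding P_def using finite_A assms by (rule dvd_prodI)
  moreover have "P \<noteq> 0" using monic_P by (auto simp: monic_def emb_def)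
  ultimately have "degree (g i) \<le> degree P" by (rule dvd_imp_degree_le)
  then have "x \<in> codespace k (degree P)" by (rule codespace_mono[OF x])
  then show "x \<in> skrem k \<Theta> (emb (g i)) ` codespace k (degree P)"
    using skrem_ident[OF monic_g[OF assms] x] by (metis imageI)
qed

lemma crt_map_inj:
  assumes "A = {i1, i2, i3, i4}"
  shows "inj_on (crt_map k \<Theta> (emb (g i1)) (emb (g i2)) (emb (g i3)) (emb (g i4)))
    (codespace k (degree P))"
proof (rule inj_onI)
  fix a b
  assume ab: "a \<in> codespace k (degree P)" "b \<in> codespace k (degree P)"
    and eq: "crt_map k \<Theta> (emb (g i1)) (emb (g i2)) (emb (g i3)) (emb (g i4)) a =
      crt_map k \<Theta> (emb (g i1)) (emb (g i2)) (emb (g i3)) (emb (g i4)) b"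
  show "a = b"
    by (rule skrem_components_inj[OF ab]) (use eq in \<open>auto simp: crt_map_def assms\<close>)
qed

lemma crt_map_image:
  assumes A: "A = {i1, i2, i3, i4}" "distinct [i1, i2, i3, i4]"
    and I: "left_ideal_mod k \<Theta> (emb P) I"
  shows "crt_map k \<Theta> (emb (g i1)) (emb (g i2)) (emb (g i3)) (emb (g i4)) ` I =
    skrem k \<Theta> (emb (g i1)) ` I \<times> skrem k \<Theta> (emb (g i2)) ` I \<times>
    skrem k \<Theta> (emb (g i3)) ` I \<times> skrem k \<Theta> (emb (g i4)) ` I" (is "?L = ?R")
proof
  show "?L \<subseteq> ?R" by (auto simp: crt_map_def)
  show "?R \<subseteq> ?L"
  proof
    fix x assume "x \<in> ?R"
    then obtain c1 c2 c3 c4 where c: "c1 \<in> I" "c2 \<in> I" "c3 \<in> I" "c4 \<in> I"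
      "x = (skrem k \<Theta> (emb (g i1)) c1, skrem k \<Theta> (emb (g i2)) c2,
            skrem k \<Theta> (emb (g i3)) c3, skrem k \<Theta> (emb (g i4)) c4)"
      by auto
    \<comment> \<open>The four preimages as a family over the index set: the default value
      \<open>c4\<close> serves \<open>i4\<close>, and distinctness keeps the updates apart.\<close>
    define c where "c = (\<lambda>_. c4)(i1 := c1, i2 := c2, i3 := c3)"
    have "\<exists>a\<in>I. \<forall>j\<in>A. skrem k \<Theta> (emb (g j)) a = skrem k \<Theta> (emb (g j)) (c j)"
      by (rule chinese_remainder[OF I]) (use c in \<open>simp add: c_def\<close>)
    then obtain a where a: "a \<in> I"
      "\<And>j. j \<in> A \<Longrightarrow> skrem k \<Theta> (emb (g j)) a = skrem k \<Theta> (emb (g j)) (c j)" by blast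
    have "x = crt_map k \<Theta> (emb (g i1)) (emb (g i2)) (emb (g i3)) (emb (g i4)) a"
      using A by (auto simp: crt_map_def a(2) c(5) c_def)
    then show "x \<in> ?L" using a(1) by (rule image_eqI)
  qed
qed

text \<open>Surjectivity is the image formula for the whole space, regarded as a left ideal.\<close>

lemma crt_map_bij_betw:
  assumes A: "A = {i1, i2, i3, i4}" "distinct [i1, i2, i3, i4]"
  shows "bij_betw (crt_map k \<Theta> (emb (g i1)) (emb (g i2)) (emb (g i3)) (emb (g i4)))
    (codespace k (degree P))
    (quot_reps k (emb (g i1)) \<times> quot_reps k (emb (g i2)) \<times>
     quot_reps k (emb (g i3)) \<times> quot_reps k (emb (g i4)))"
proof -
  have "i1 \<in> A" "i2 \<in> A" "i3 \<in> A" "i4 \<in> A" using A(1) by simp_all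
  then show ?thesis
    using crt_map_inj[OF A(1)] crt_map_image[OF A left_ideal_mod_codespace[OF monic_P]]
    by (simp add: bij_betw_def skrem_image_codespace quot_reps_monic[OF monic_g])
qed

lemma card_left_ideal:
  assumes A: "A = {i1, i2, i3, i4}" "distinct [i1, i2, i3, i4]"
    and I: "left_ideal_mod k \<Theta> (emb P) I"
  shows "card I = card (skrem k \<Theta> (emb (g i1)) ` I) * card (skrem k \<Theta> (emb (g i2)) ` I) *
    card (skrem k \<Theta> (emb (g i3)) ` I) * card (skrem k \<Theta> (emb (g i4)) ` I)"
proof -
  have "I \<subseteq> codespace k (degree P)" using I unfolding left_ideal_mod_iff[OF monic_P] by (rule conjunct1)
  from card_image[OF inj_on_subset[OF crt_map_inj[OF A(1)] this]]
  show ?thesis unfolding crt_map_image[OF A I] by (simp add: card_cartesian_product mult.assoc)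
qed

text \<open>\<open>crt_map\<close> is injective and sends each left ideal to the product of its
  components, so the components determine the ideal.\<close>

lemma left_ideal_eq_iff:
  assumes A: "A = {i1, i2, i3, i4}" "distinct [i1, i2, i3, i4]"
    and I: "left_ideal_mod k \<Theta> (emb P) I" and J: "left_ideal_mod k \<Theta> (emb P) J"
  shows "I = J \<longleftrightarrow> (\<forall>i\<in>A. skrem k \<Theta> (emb (g i)) ` I = skrem k \<Theta> (emb (g i)) ` J)"
proof
  assume eq: "\<forall>i\<in>A. skrem k \<Theta> (emb (g i)) ` I = skrem k \<Theta> (emb (g i)) ` J"
  have sub: "I \<subseteq> codespace k (degree P)" "J \<subseteq> codespace k (degree P)"
    using I J unfolding left_ideal_mod_iff[OF monic_P] by simp_all
  show "I = J"
    using inj_on_image_eq_iff[OF crt_map_inj[OF A(1)] sub]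
    unfolding crt_map_image[OF A I] crt_map_image[OF A J] using eq A(1) by simp
qed simp

end

section \<open>Negacyclic shifts and the Euclidean dual\<close>

definition negacyclic_poly :: "nat \<Rightarrow> 'a::field poly" where
  "negacyclic_poly N = monom 1 N + 1"

lemma degree_negacyclic_poly: "0 < N \<Longrightarrow> degree (negacyclic_poly N) = N"
  unfolding negacyclic_poly_def by (subst degree_add_eq_left) (simp_all add: degree_monom_eq)

lemma coeff_negacyclic_poly:
  "0 < N \<Longrightarrow> coeff (negacyclic_poly N) n = (if n = 0 \<or> n = N then 1 else 0)"
  by (auto simp: negacyclic_poly_def coeff_1)

context skew_poly_ring
begin

lemma central_negacyclic_poly:
  assumes "0 < N" "\<forall>a\<in>R. (\<Theta> ^^ N) a = a"
  shows "central_poly (negacyclic_poly N)"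
  using assms by (auto simp: central_poly_def fixed_poly_def coeff_negacyclic_poly simp flip: one_pCons)

lemma monic_negacyclic_poly: "0 < N \<Longrightarrow> monic N (emb (negacyclic_poly N))"
  using monic_emb[of "negacyclic_poly N"] by (simp add: degree_negacyclic_poly coeff_negacyclic_poly)

lemma codespace_const_mult:
  "a \<in> codespace k M \<Longrightarrow> skp_const c \<star> a \<in> codespace k M"
  by (simp add: codespace_iff skp_const_mult)

lemma skp_X_S [simp, intro]: "skp_X \<in> S"
  by (simp add: skp_X_eq_emb)

text \<open>Since \<open>x^N = -1\<close> in the quotient, the top coefficient wraps around with a
  sign, and every coefficient is twisted by \<open>\<Theta>\<close>.\<close>

lemma skrem_X_mult:
  assumes N: "0 < N" and d: "d \<in> codespace k N"
  shows "skrem k \<Theta> (emb (negacyclic_poly N)) (skp_X \<star> d) =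
    (\<lambda>n. if n = 0 then - \<Theta> (d (N - 1)) else if n < N then \<Theta> (d (n - 1)) else 0)"
    (is "_ = ?T")
proof (rule skrem_eqI[OF monic_negacyclic_poly[OF N]])
  have dR: "d n \<in> R" for n using d by (simp add: codespace_iff)
  \<comment> \<open>The quotient is a constant: the overflow of the product at degree
    \<open>N\<close>.\<close>
  show "skp_const (\<Theta> (d (N - 1))) \<in> S" using dR by (intro skp_const_S Theta_closed)
  show "?T \<in> codespace k N" using dR N by (auto simp: codespace_iff Theta_closed Rk_uminus)
  show "skp_X \<star> d = skp_const (\<Theta> (d (N - 1))) \<star> emb (negacyclic_poly N) + ?T"
  proof
    fix n
    have "d (n - 1) = 0" if "n > N" using d that by (simp add: codespace_iff)
    then show "(skp_X \<star> d) n = (skp_const (\<Theta> (d (N - 1))) \<star> emb (negacyclic_poly N) + ?T) n"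
      using N dR codespace_S[OF d]
      by (auto simp: skp_X_mult skp_const_mult emb_def coeff_negacyclic_poly Theta_closed
          simp flip: one_pCons)
  qed
qed

text \<open>A Horner step with \<open>x\<close> on the right, where the twist meets only the
  coefficient 1 of \<open>x\<close> and the coefficients of \<open>r\<close> stay as they
  are.\<close>

lemma skp_split_X:
  assumes "r \<in> codespace k (Suc M)"
  shows "r = skp_const (r 0) + (\<lambda>n. r (Suc n)) \<star> skp_X"
proof
  fix n
  have rR: "r i \<in> R" for i using assms by (simp add: codespace_iff)
  have "((\<lambda>n. r (Suc n)) \<star> skp_X) n = (\<Sum>i\<le>n. if Suc i = n then r n else 0)"
    unfolding skp_mult_def skp_X_def using rR by (intro sum.cong) auto
  also have "\<dots> = (if n = 0 then 0 else r n)" by (cases n) simp_all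
  finally show "r n = (skp_const (r 0) + (\<lambda>n. r (Suc n)) \<star> skp_X) n"
    by (simp add: skp_const_def)
qed

text \<open>By Horner's scheme, left multiplication by any \<open>r\<close> is composed of scalar
  multiplications, additions and single shifts.\<close>

lemma left_ideal_mod_by_shift:
  assumes f: "monic N f" and I: "I \<subseteq> codespace k N" "0 \<in> I"
    and add: "\<And>a b. a \<in> I \<Longrightarrow> b \<in> I \<Longrightarrow> a + b \<in> I"
    and const: "\<And>c a. c \<in> R \<Longrightarrow> a \<in> I \<Longrightarrow> skp_const c \<star> a \<in> I"
    and shift: "\<And>a. a \<in> I \<Longrightarrow> skrem k \<Theta> f (skp_X \<star> a) \<in> I"
  shows "left_ideal_mod k \<Theta> f I"
  unfolding left_ideal_mod_iff[OF f]
proof (intro conjI ballI I add)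
  fix a assume "a \<in> I"
  then have "skp_const (- 1) \<star> a \<in> I" by (intro const Rk_uminus R_simps)
  moreover have "a n \<in> R" for n using \<open>a \<in> I\<close> I(1) by (auto simp: codespace_iff)
  then have "skp_const (- 1) \<star> a = - a" by (intro ext) (simp add: skp_const_mult)
  ultimately show "- a \<in> I" by simp
next
  fix r a :: "'a skp" assume "r \<in> codespace k N" "a \<in> I"
  then show "skrem k \<Theta> f (r \<star> a) \<in> I"
  \<comment> \<open>The induction runs over the length bound of \<open>r\<close> alone;
    \<open>f\<close> and \<open>I\<close> keep the original length \<open>N\<close>.\<close>
  proof (induction N arbitrary: r a)
    case 0
    then have "r = 0" by (auto simp: codespace_iff)
    then show ?case using I(2) skrem_zero[OF f] by (metis skp_mult_zero(1))
  next
    case (Suc M)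
    define r' where "r' = (\<lambda>n. r (Suc n))"
    have r': "r' \<in> codespace k M" using Suc.prems(1) by (auto simp: codespace_iff r'_def)
    then have r'S: "r' \<in> S" by (rule codespace_S)
    have aN: "a \<in> codespace k N" using Suc.prems(2) I(1) by (rule subsetD[rotated])
    then have aS: "a \<in> S" by (rule codespace_S)
    have r0: "r 0 \<in> R" using Suc.prems(1) by (simp add: codespace_iff)
    have XaS: "skp_X \<star> a \<in> S" by (rule S_mult[OF skp_X_S aS])
    have "r \<star> a = (skp_const (r 0) + r' \<star> skp_X) \<star> a"
      unfolding r'_def by (rule arg_cong[OF skp_split_X[OF Suc.prems(1)]])
    also have "\<dots> = skp_const (r 0) \<star> a + r' \<star> (skp_X \<star> a)"
      by (simp add: skp_mult_add_left skp_mult_assoc[OF r'S skp_X_S aS])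
    finally have "skrem k \<Theta> f (r \<star> a)
        = skrem k \<Theta> f (skp_const (r 0) \<star> a) + skrem k \<Theta> f (r' \<star> (skp_X \<star> a))"
      using skrem_add[OF f S_mult[OF skp_const_S[OF r0] aS] S_mult[OF r'S XaS]] by simp
    also have "\<dots> = skp_const (r 0) \<star> a + skrem k \<Theta> f (r' \<star> skrem k \<Theta> f (skp_X \<star> a))"
      by (simp add: skrem_ident[OF f codespace_const_mult[OF aN]] skrem_mult_skrem[OF f r'S XaS])
    also have "\<dots> \<in> I"
      by (rule add[OF const[OF r0 Suc.prems(2)] Suc.IH[OF r' shift[OF Suc.prems(2)]]])
    finally show ?case .
  qed
qed

lemma left_ideal_mod_euclid_dual:
  assumes N: "0 < N" "\<forall>a\<in>R. (\<Theta> ^^ N) a = a"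
    and C: "left_ideal_mod k \<Theta> (emb (negacyclic_poly N)) C"
  shows "left_ideal_mod k \<Theta> (emb (negacyclic_poly N)) (euclid_dual k N C)"
proof -
  let ?P = "negacyclic_poly N :: 'a poly"
  let ?T = "\<lambda>c. skrem k \<Theta> (emb ?P) (skp_X \<star> c)"
  note F = monic_negacyclic_poly[OF N(1)]
  note C' = C[unfolded left_ideal_mod_iff[OF F]]
  have CN: "c \<in> codespace k N" if "c \<in> C" for c using C' that by (meson subsetD)
  \<comment> \<open>Modulo \<open>x^N + 1\<close> the element \<open>x\<close> is a unit with
    inverse \<open>- x^(N-1)\<close>, so every codeword is the shift of a codeword.\<close>
  have unshift: "\<exists>c'\<in>C. ?T c' = c" if c: "c \<in> C" for c
  proof
    let ?m = "- monom 1 (N - 1) :: 'a poly"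
    have cS: "c \<in> S" using CN[OF c] by (rule codespace_S)
    show "skrem k \<Theta> (emb ?P) (emb ?m \<star> c) \<in> C"
    proof -
      have "emb ?m \<in> codespace k N" using N(1) by (intro emb_codespace) (simp add: degree_monom_eq)
      then show ?thesis using C' c by simp
    qed
    have fix_m: "fixed_poly ?m"
    proof -
      have "\<Theta> [:1:] = [:1:]" using Theta_one by (simp only: one_pCons)
      moreover from this have "\<Theta> [:- 1:] = [:- 1:]" using Theta_uminus[of "[:1:]"] by simp
      ultimately show ?thesis by (simp add: fixed_poly_def)
    qed
    have "?T (skrem k \<Theta> (emb ?P) (emb ?m \<star> c)) = skrem k \<Theta> (emb ?P) (skp_X \<star> (emb ?m \<star> c))"
      by (rule skrem_mult_skrem[OF F skp_X_S S_mult[OF emb_S cS]])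
    also have "skp_X \<star> (emb ?m \<star> c) = emb ([:0, 1:] * ?m) \<star> c"
      unfolding emb_mult[OF fix_m] skp_X_eq_emb by (rule skp_mult_assoc[symmetric, OF emb_S emb_S cS])
    also have "[:0, 1:] * ?m = - ?P + 1"
      using N(1) by (simp add: negacyclic_poly_def monom_Suc[symmetric])
    also have "emb (- ?P + 1) \<star> c = (- c) \<star> emb ?P + c"
      using cS emb_central[OF central_negacyclic_poly[OF N] cS]
      by (simp add: emb_diff skp_mult_diff_left skp_mult_uminus_left
          flip: skp_const_one_eq_emb)
    also have "skrem k \<Theta> (emb ?P) \<dots> = c"
      using skrem_eqI[OF F S_uminus[OF cS] CN[OF c] refl] .
    finally show "?T (skrem k \<Theta> (emb ?P) (emb ?m \<star> c)) = c" .
  qed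
  \<comment> \<open>The wrapped coordinate is negated in both arguments, so the signs cancel; the
    other products move one place, and \<open>\<Theta>\<close> comes out of the sum.\<close>
  have inner_shift: "(\<Sum>i<N. ?T c i \<odot> ?T d i) = \<Theta> (\<Sum>i<N. c i \<odot> d i)"
    if c: "c \<in> codespace k N" and d: "d \<in> codespace k N" for c d
  proof -
    obtain M where M: "N = Suc M" using N(1) by (cases N) auto
    have R: "c i \<in> R" "d i \<in> R" for i using c d by (auto simp: codespace_iff)
    have "(\<Sum>i<N. ?T c i \<odot> ?T d i) = (\<Sum>i<M. \<Theta> (c i) \<odot> \<Theta> (d i)) + \<Theta> (c M) \<odot> \<Theta> (d M)"
      unfolding skrem_X_mult[OF N(1) c] skrem_X_mult[OF N(1) d] unfolding M
      by (simp add: sum.lessThan_Suc_shift del: sum.lessThan_Suc)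
    also have "\<dots> = \<Theta> (\<Sum>i<N. c i \<odot> d i)"
      unfolding M using R by (subst Theta_sum) (auto simp: Theta_mult)
    finally show ?thesis .
  qed
  show ?thesis
  proof (rule left_ideal_mod_by_shift[OF F])
    show "euclid_dual k N C \<subseteq> codespace k N" by (auto simp: euclid_dual_def)
    show "0 \<in> euclid_dual k N C" by (simp add: euclid_dual_def)
  next
    fix a b assume "a \<in> euclid_dual k N C" "b \<in> euclid_dual k N C"
    then show "a + b \<in> euclid_dual k N C"
      by (auto simp: euclid_dual_def Rk_mult_add_right sum.distrib)
  next
    fix c a assume c: "c \<in> R" and a: "a \<in> euclid_dual k N C"
    have "(\<Sum>i<N. b i \<odot> (skp_const c \<star> a) i) = c \<odot> (\<Sum>i<N. b i \<odot> a i)" for b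
      unfolding skp_const_mult Rk_mult_sum_right
      by (metis (no_types) Rk_mult_assoc Rk_mult_commute)
    then show "skp_const c \<star> a \<in> euclid_dual k N C"
      using a by (simp add: euclid_dual_def codespace_const_mult)
  next
    fix a assume a: "a \<in> euclid_dual k N C"
    then have aN: "a \<in> codespace k N" by (simp add: euclid_dual_def)
    have "(\<Sum>i<N. c i \<odot> ?T a i) = 0" if c: "c \<in> C" for c
    proof -
      \<comment> \<open>To test orthogonality against \<open>c\<close>, view it as the shift of a
        codeword \<open>c'\<close>; the inner product is then \<open>\<Theta> 0\<close>.\<close>
      obtain c' where c': "c' \<in> C" "?T c' = c" using unshift[OF c] by (elim bexE) (rule that)
      have "(\<Sum>i<N. c' i \<odot> a i) = 0" using a c'(1) by (simp add: euclid_dual_def)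
      then show ?thesis using inner_shift[OF CN[OF c'(1)] aN] c'(2) by simp
    qed
    moreover have "?T a \<in> codespace k N"
      by (rule skrem_closed[OF F S_mult[OF skp_X_S codespace_S[OF aN]]])
    ultimately show "?T a \<in> euclid_dual k N C" by (simp add: euclid_dual_def)
  qed
qed

end

section \<open>Arithmetic over the finite field\<close>

text \<open>Translation by 1 permutes the field, so summing all elements shows that the cardinality
  vanishes in it; the characteristic is thus a prime dividing \<open>p ^ m\<close>.\<close>

lemma CHAR_finite_field:
  assumes "prime p" "CARD('a::{field,finite}) = p ^ m"
  shows "CHAR('a) = p"
proof -
  have "(\<Sum>x\<in>(UNIV :: 'a set). x + 1) = (\<Sum>x\<in>UNIV. x)"
    by (rule sum.reindex_bij_witness[of _ "\<lambda>x. x - 1" "\<lambda>x. x + 1"]) auto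
  then have "of_nat CARD('a) = (0 :: 'a)" by (simp add: sum.distrib)
  then have "CHAR('a) dvd p ^ m" using assms(2) by (metis of_nat_eq_0_iff_char_dvd)
  moreover have "prime CHAR('a)" by (intro prime_CHAR_semidom finite_imp_CHAR_pos) simp
  ultimately show ?thesis
    using assms(1) by (metis prime_dvd_power primes_dvd_imp_eq)
qed

text \<open>Fermat's little theorem for the prime field, from additivity of the Frobenius
  map.\<close>

lemma of_nat_power_CHAR:
  assumes "prime CHAR('a::field)"
  shows "(of_nat n :: 'a) ^ CHAR('a) = of_nat n"
  using prime_gt_0_nat[OF assms]
  by (induction n) (simp_all add: freshmans_dream[OF assms refl])

text \<open>With \<open>q = CHAR('a) ^ s\<close>, the freshman's dream turns each Horner step
  \<open>a + x f\<close> into \<open>a^q + x^q f^q\<close>, so only multiples of \<open>q\<close>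
  survive as exponents.\<close>

lemma coeff_power_CHAR_pow:
  fixes f :: "'a::field poly"
  assumes "prime CHAR('a)" "coeff (f ^ (CHAR('a) ^ s)) n \<noteq> 0"
  shows "CHAR('a) ^ s dvd n"
  using assms(2)
proof (induction f arbitrary: n)
  case 0
  then show ?case using assms(1) by (simp add: power_0_left prime_gt_0_nat)
next
  case (pCons a f)
  let ?q = "CHAR('a) ^ s"
  have "pCons a f ^ ?q = ([:a:] + monom 1 1 * f) ^ ?q"
    by (simp add: monom_Suc)
  also have "\<dots> = [:a:] ^ ?q + monom 1 1 ^ ?q * f ^ ?q"
    using freshmans_dream'[where ?'a = "'a poly" and x = "[:a:]" and y = "monom 1 1 * f" and n = s, OF _ refl] assms(1)
    by (simp add: power_mult_distrib)
  also have "\<dots> = [:a ^ ?q:] + monom 1 ?q * f ^ ?q"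
    by (simp add: poly_const_pow monom_power)
  finally have "coeff [:a ^ ?q:] n \<noteq> 0 \<or> (n \<ge> ?q \<and> coeff (f ^ ?q) (n - ?q) \<noteq> 0)"
    using pCons.prems by (auto simp: coeff_monom_mult split: if_splits)
  then show ?case
  proof
    assume "coeff [:a ^ ?q:] n \<noteq> 0"
    then show ?thesis by (cases n) auto
  next
    assume n: "n \<ge> ?q \<and> coeff (f ^ ?q) (n - ?q) \<noteq> 0"
    then have "?q dvd (n - ?q) + ?q" using pCons.IH by (intro dvd_add) simp_all
    then show ?thesis using n by simp
  qed
qed

text \<open>For \<open>h = (p - 1) / 2\<close> the element \<open>\<xi>^h\<close> squares to 1 by
  Fermat and differs from 1 because \<xi> is a generator. As \<open>h\<close> is even,
  \<open>\<xi>^h\<close> is the square of \<open>\<xi>^(h/2)\<close>, which is \<alpha>.\<close>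

lemma alpha_of_square:
  fixes \<xi> :: "'a::field"
  assumes p: "prime p" "p mod 4 = 1" "CHAR('a) = p"
    and \<xi>: "\<xi> \<in> range of_nat" "\<xi> \<noteq> 0"
    and gen: "\<forall>y\<in>range (of_nat :: nat \<Rightarrow> 'a). y \<noteq> 0 \<longrightarrow> (\<exists>j. y = \<xi> ^ j)"
  shows "alpha_of \<xi> p * alpha_of \<xi> p = - 1"
proof -
  define h where "h = (p - 1) div 2"
  have ph: "p = 2 * h + 1" "0 < h" "(p - 1) div 4 + (p - 1) div 4 = h"
    using p(2) prime_gt_1_nat[OF p(1)] unfolding h_def by presburger+
  have "\<xi> ^ p = \<xi>" using \<xi>(1) of_nat_power_CHAR[where ?'a = 'a, unfolded p(3), OF p(1)] by (elim rangeE) simp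
  then have "\<xi> * (\<xi> ^ h * \<xi> ^ h) = \<xi> * 1" by (simp add: ph(1) power_add mult_2)
  then have "\<xi> ^ h * \<xi> ^ h = 1" using \<xi>(2) by (simp only: mult_cancel_left simp_thms)
  then have "\<xi> ^ h = 1 \<or> \<xi> ^ h = - 1" by (simp add: square_eq_1_iff)
  moreover have "\<xi> ^ h \<noteq> 1"
  proof
    assume 1: "\<xi> ^ h = 1"
    \<comment> \<open>If \<open>\<xi>^h = 1\<close>, the powers of \<xi> take at most
      \<open>h\<close> values, too few for the \<open>p - 1 = 2 h\<close> nonzero residues.\<close>
    have "of_nat ` {1..<p} \<subseteq> (\<lambda>j. \<xi> ^ j) ` {..<h}"
    proof
      fix y :: 'a assume "y \<in> of_nat ` {1..<p}"
      then obtain n where n: "y = of_nat n" "1 \<le> n" "n < p" by auto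
      then have "y \<noteq> 0" using p(3) by (auto simp: of_nat_eq_0_iff_char_dvd dest: dvd_imp_le)
      then obtain j where "y = \<xi> ^ j" using gen n(1) by blast
      also have "\<dots> = \<xi> ^ (h * (j div h) + j mod h)" by simp
      also have "\<dots> = \<xi> ^ (j mod h)" by (simp only: power_add power_mult 1 power_one mult_1_left)
      finally show "y \<in> (\<lambda>j. \<xi> ^ j) ` {..<h}" using ph(2) by auto
    qed
    then have "card (of_nat ` {1..<p} :: 'a set) \<le> card ((\<lambda>j. \<xi> ^ j) ` {..<h})"
      by (intro card_mono) auto
    also have "\<dots> \<le> h" using card_image_le[of "{..<h}"] by simp
    finally have "card (of_nat ` {1..<p} :: 'a set) \<le> h" .
    moreover have "inj_on (of_nat :: nat \<Rightarrow> 'a) {1..<p}"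
    proof (rule linorder_inj_onI)
      fix m n assume "m < n" "m \<in> {1..<p}" "n \<in> {1..<p}"
      then show "of_nat m \<noteq> (of_nat n :: 'a)"
        using p(3) by (auto simp: of_nat_eq_iff_char_dvd dest: dvd_imp_le)
    qed auto
    ultimately show False using ph(1,2) by (simp add: card_image)
  qed
  ultimately show ?thesis unfolding alpha_of_def power_add[symmetric] ph(3) by simp
qed

text \<open>Lying in the prime field is what makes \<alpha> fixed by
  \<open>\<Theta>\<close>.\<close>

lemma alpha_of_in_range:
  assumes "\<xi> \<in> range of_nat"
  shows "alpha_of \<xi> p \<in> range of_nat"
  using assms unfolding alpha_of_def by (metis imageE of_nat_power rangeI)

section \<open>The decomposition of negacyclic codes\<close>

lemma fac_lin_eq_emb:
  assumes "skew_poly_ring k \<Theta>" "\<Theta> [:c:] = [:c:]"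
  shows "fac_lin k \<Theta> c e = emb ([:- c, 1:] ^ e)"
proof -
  interpret skew_poly_ring k \<Theta> by fact
  have "skp_minus skp_X (skp_const [:c:]) = emb [:- c, 1:]"
    by (simp add: skp_minus_eq skp_X_eq_emb skp_const_eq_emb flip: emb_diff)
  moreover have "fixed_poly [:- c, 1:]"
    using Theta_uminus[of "[:c:]"] assms(2) Theta_one by (intro fixed_poly_pCons) (simp_all add: one_pCons)
  ultimately show ?thesis by (simp add: fac_lin_def emb_power)
qed

lemma fac_quad_eq_emb:
  assumes "skew_poly_ring k \<Theta>" "\<Theta> [:c:] = [:c:]"
  shows "fac_quad k \<Theta> c e = emb ([:- 1, c, 1:] ^ e)"
proof -
  interpret skew_poly_ring k \<Theta> by fact
  have X: "fixed_poly [:0, 1:]" and F: "fixed_poly [:- 1, c, 1:]"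
    using Theta_uminus[of "[:1:]"] assms(2) Theta_one
    by (auto intro!: fixed_poly_pCons simp: one_pCons)
  have "skp_minus (skp_add (skp_mult k \<Theta> skp_X skp_X) (skp_mult k \<Theta> (skp_const [:c:]) skp_X))
      (skp_const 1) = emb ([:0, 1:] * [:0, 1:] + [:c:] * [:0, 1:] - 1)"
    unfolding skp_minus_eq skp_add_eq skp_X_eq_emb skp_const_eq_emb skp_const_one_eq_emb
      emb_diff emb_add emb_mult[OF X] by (rule refl)
  also have "[:0, 1:] * [:0, 1:] + [:c:] * [:0, 1:] - 1 = [:- 1, c, 1:]"
    by (simp add: one_pCons)
  finally show ?thesis using F by (simp add: fac_quad_def emb_power)
qed

theorem theorem5p2:
  fixes p m k s :: nat and \<Theta> :: "'a::{field,finite} poly \<Rightarrow> 'a poly"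
    and \<xi> :: 'a and C :: "'a skp set"
  assumes "prime p" and "p mod 12 = 5" and "odd m" and "CARD('a) = p ^ m" and "1 \<le> k"
    and "Rk_aut k \<Theta>" and "\<forall>a\<in>Rk_carrier k. (\<Theta> ^^ (p ^ s)) a = a"
    and "\<xi> \<in> range of_nat" and "\<xi> \<noteq> 0"
    and "\<forall>y\<in>range (of_nat :: nat \<Rightarrow> 'a). y \<noteq> 0 \<longrightarrow> (\<exists>j. y = \<xi> ^ j)"
    and "skew_negacyclic_code k \<Theta> (6 * p ^ s) C"
  shows "let N = 6 * p ^ s; \<alpha> = alpha_of \<xi> p;
      f1 = fac_lin k \<Theta> \<alpha> (p ^ s); f2 = fac_lin k \<Theta> (- \<alpha>) (p ^ s);
      f3 = fac_quad k \<Theta> \<alpha> (p ^ s); f4 = fac_quad k \<Theta> (inverse \<alpha>) (p ^ s);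
      \<phi> = crt_map k \<Theta> f1 f2 f3 f4;
      C1 = skrem k \<Theta> f1 ` C; C2 = skrem k \<Theta> f2 ` C;
      C3 = skrem k \<Theta> f3 ` C; C4 = skrem k \<Theta> f4 ` C;
      D = euclid_dual k N C;
      D1 = skrem k \<Theta> f2 ` D; D2 = skrem k \<Theta> f1 ` D;
      D3 = skrem k \<Theta> f4 ` D; D4 = skrem k \<Theta> f3 ` D
    in skp_add (skp_pow k \<Theta> skp_X N) (skp_const 1)
           = skp_mult k \<Theta> (skp_mult k \<Theta> (skp_mult k \<Theta> f1 f2) f3) f4
      \<and> bij_betw \<phi> (codespace k N)
          (quot_reps k f1 \<times> quot_reps k f2 \<times> quot_reps k f3 \<times> quot_reps k f4)
      \<and> left_ideal_mod k \<Theta> f1 C1 \<and> left_ideal_mod k \<Theta> f2 C2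
      \<and> left_ideal_mod k \<Theta> f3 C3 \<and> left_ideal_mod k \<Theta> f4 C4
      \<and> \<phi> ` C = C1 \<times> C2 \<times> C3 \<times> C4
      \<and> card C = card C1 * card C2 * card C3 * card C4
      \<and> left_ideal_mod k \<Theta> f2 D1 \<and> left_ideal_mod k \<Theta> f1 D2
      \<and> left_ideal_mod k \<Theta> f4 D3 \<and> left_ideal_mod k \<Theta> f3 D4
      \<and> \<phi> ` D = D2 \<times> D1 \<times> D4 \<times> D3
      \<and> (D = C \<longleftrightarrow> C1 = D2 \<and> C2 = D1 \<and> C3 = D4 \<and> C4 = D3)"
proof -
  interpret skew_poly_ring k \<Theta> using assms(5,6) by unfold_locales
  define q where "q = p ^ s"
  define N where "N = 6 * q"
  define \<alpha> where "\<alpha> = alpha_of \<xi> p"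
  \<comment> \<open>The factors before raising to the power \<open>q\<close>. The last one has
    \<open>- \<alpha>\<close> where the statement has \<open>inverse \<alpha>\<close>; they agree
    because \<open>\<alpha>^2 = -1\<close>.\<close>
  define b where "b i = [[:- \<alpha>, 1:], [:\<alpha>, 1:], [:- 1, \<alpha>, 1:], [:- 1, - \<alpha>, 1:]] ! i" for i
  define g where "g i = b i ^ q" for i
  define D where "D = euclid_dual k N C"
  have b_simps: "b 0 = [:- \<alpha>, 1:]" "b 1 = [:\<alpha>, 1:]" "b 2 = [:- 1, \<alpha>, 1:]" "b 3 = [:- 1, - \<alpha>, 1:]"
    by (simp_all add: b_def numeral_2_eq_2 numeral_3_eq_3)
  have char: "CHAR('a) = p" by (rule CHAR_finite_field[OF assms(1,4)])
  have "p mod 4 = 1" using assms(2) by presburger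
  then have \<alpha>2: "\<alpha> * \<alpha> = - 1"
    unfolding \<alpha>_def using alpha_of_square[OF assms(1) _ char assms(8-10)] by blast
  have \<alpha>_inv: "inverse \<alpha> = - \<alpha>" by (rule inverse_unique) (simp add: \<alpha>2)
  have ne0: "\<alpha> \<noteq> 0" using \<alpha>2 by auto
  have p5: "5 \<le> p" using assms(2) by (metis mod_less_eq_dividend)
  have of_nat_ne0: "(of_nat n :: 'a) \<noteq> 0" if "0 < n" "n < 5" for n
    using that p5 by (auto simp: of_nat_eq_0_iff_char_dvd char dest: dvd_imp_le)
  have two: "(2 :: 'a) \<noteq> 0" and three: "(3 :: 'a) \<noteq> 0"
    using of_nat_ne0[of 2] of_nat_ne0[of 3] by simp_all
  have q0: "0 < q" using assms(1) by (simp add: q_def prime_gt_0_nat)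
  then have N0: "0 < N" by (simp add: N_def)

  have \<Theta>\<alpha>: "\<Theta> [:\<alpha>:] = [:\<alpha>:]" "\<Theta> [:- \<alpha>:] = [:- \<alpha>:]"
    using alpha_of_in_range[OF assms(8), of p] Theta_const_of_nat Theta_uminus[of "[:\<alpha>:]"]
    by (auto simp: \<alpha>_def)
  have \<Theta>1: "\<Theta> [:1:] = [:1:]" "\<Theta> [:- 1:] = [:- 1:]"
    using Theta_one Theta_uminus[of 1] by (simp_all add: one_pCons)
  have \<Theta>q: "(\<Theta> ^^ n) a = a" if "q dvd n" "a \<in> R" for n a
  proof -
    have "((\<Theta> ^^ q) ^^ j) a = a" for j using assms(7) that(2) by (induction j) (auto simp: q_def)
    then show ?thesis using that(1) by (auto simp: funpow_mult mult.commute elim: dvdE)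
  qed
  have \<Theta>N: "\<forall>a\<in>R. (\<Theta> ^^ N) a = a" using \<Theta>q by (simp add: N_def)

  have fixed_b: "fixed_poly (b i)" if "i < 4" for i
  proof -
    have "i \<in> {0, 1, 2, 3}" using that by auto
    then show ?thesis using \<Theta>\<alpha> \<Theta>1 by (auto simp: b_simps[unfolded One_nat_def] intro!: fixed_poly_pCons)
  qed
  have comax_b: "comaximal (b i) (b j)" if "i < j" "j < 4" for i j
  proof -
    \<comment> \<open>A linear factor is comaximal with any polynomial not vanishing at its root.
      The values are \<open>2 \<alpha>\<close>, \<open>-3\<close> and \<open>-1\<close>, which is
      why 2 and 3 must be nonzero.\<close>
    have "poly (b 1) \<alpha> = 2 * \<alpha>" "poly (b 2) \<alpha> = 2 * (\<alpha> * \<alpha>) - 1"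
        "poly (b 3) \<alpha> = - 1" "poly (b 2) (- \<alpha>) = - 1" "poly (b 3) (- \<alpha>) = 2 * (\<alpha> * \<alpha>) - 1"
      unfolding b_simps by (simp_all add: algebra_simps)
    then have vals: "poly (b 1) \<alpha> = 2 * \<alpha>" "poly (b 2) \<alpha> = - 3"
        "poly (b 3) \<alpha> = - 1" "poly (b 2) (- \<alpha>) = - 1" "poly (b 3) (- \<alpha>) = - 3"
      unfolding \<alpha>2 by simp_all
    then have "poly (b j) \<alpha> \<noteq> 0" if "j \<in> {1, 2, 3}" for j
      using that two three ne0 by auto
    moreover have "poly (b j) (- \<alpha>) \<noteq> 0" if "j \<in> {2, 3}" for j
      using vals that three by auto
    ultimately have lin: "j \<in> {1, 2, 3} \<Longrightarrow> comaximal (b 0) (b j)"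
        "j \<in> {2, 3} \<Longrightarrow> comaximal (b 1) (b j)" for j
      using comaximal_linear[of "b j" \<alpha>] comaximal_linear[of "b j" "- \<alpha>"]
      unfolding b_simps(1,2) by auto
    \<comment> \<open>Because \<open>\<alpha>^2 + 1 = 0\<close>, the two products are
      \<open>- y^3 - \<alpha>\<close> and \<open>y^3 - \<alpha>\<close>: the cofactors complete the
      quadratics to cubics that cancel up to a constant.\<close>
    have "[:\<alpha>, - 1:] * b 2 + [:\<alpha>, 1:] * b 3 = [:- (2 * \<alpha>):]"
      unfolding b_simps by (simp add: \<alpha>2)
    then have "smult (inverse (- (2 * \<alpha>))) ([:\<alpha>, - 1:] * b 2 + [:\<alpha>, 1:] * b 3) = 1"
      using two ne0 by (simp only: smult_pCons smult_0_right) (simp add: one_pCons)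
    then have "comaximal (b 2) (b 3)"
      unfolding smult_add_right mult_smult_left[symmetric] by (rule comaximalI)
    moreover have "i = 0 \<and> j \<in> {1, 2, 3} \<or> i = 1 \<and> j \<in> {2, 3} \<or> i = 2 \<and> j = 3"
      using that by auto
    ultimately show ?thesis using lin by metis
  qed
  interpret crt_family k \<Theta> "{..<4::nat}" g
  proof
    fix i :: nat assume i: "i \<in> {..<4}"
    \<comment> \<open>The exponents occurring in \<open>b i ^ q\<close> are multiples of
      \<open>q\<close>, and there \<open>\<Theta>\<close> acts trivially.\<close>
    show "central_poly (g i)"
      using fixed_b i coeff_power_CHAR_pow[of "b i" s] \<Theta>q assms(1)
      by (auto simp: central_poly_def g_def fixed_poly_power q_def char)
    have "i \<in> {0, 1, 2, 3}" using i by auto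
    then have "lead_coeff (b i) = 1" by (auto simp: b_simps[unfolded One_nat_def])
    then show "lead_coeff (g i) = 1" by (simp add: g_def lead_coeff_power)
    fix j :: nat assume "j \<in> {..<4}" "i \<noteq> j"
    then show "comaximal (g i) (g j)"
      unfolding g_def using i comax_b[of i j] comax_b[of j i]
      by (metis comaximal_commute comaximal_power lessThan_iff linorder_neqE_nat)
  qed simp
  have A: "{..<4::nat} = {0, 1, 2, 3}" "distinct [0, 1, 2, 3 :: nat]" by auto

  have "P = prod g {..<4}" by (rule P_def)
  also have "\<dots> = g 0 * g 1 * g 2 * g 3" unfolding A(1) by (simp add: mult.assoc)
  finally have P_prod: "P = g 0 * g 1 * g 2 * g 3" .
  also have "\<dots> = (b 0 * b 1 * b 2 * b 3) ^ q"
    by (simp add: g_def power_mult_distrib)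
  \<comment> \<open>Behind the expansion: \<open>b 1 * b 3 = y^3 - \<alpha>\<close> and
    \<open>b 0 * b 2 = y^3 + \<alpha>\<close>, with product \<open>y^6 - \<alpha>^2\<close>.\<close>
  also have "b 0 * b 1 * b 2 * b 3 = monom 1 6 + 1"
    unfolding b_simps by (simp add: \<alpha>2 one_pCons monom_altdef eval_nat_numeral)
  also have "(monom 1 6 + 1 :: 'a poly) ^ q = monom 1 6 ^ q + 1"
    using freshmans_dream'[where ?'a = "'a poly" and x = "monom 1 6" and y = 1 and n = s, OF _ refl] assms(1)
    by (simp add: q_def char)
  finally have P: "P = negacyclic_poly N"
    by (simp add: negacyclic_poly_def monom_power N_def)
  have degP: "degree P = N" by (simp add: P degree_negacyclic_poly N0)

  have f: "fac_lin k \<Theta> \<alpha> q = emb (g 0)" "fac_lin k \<Theta> (- \<alpha>) q = emb (g 1)"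
    "fac_quad k \<Theta> \<alpha> q = emb (g 2)" "fac_quad k \<Theta> (inverse \<alpha>) q = emb (g 3)"
    using fac_lin_eq_emb[OF skew_poly_ring_axioms \<Theta>\<alpha>(1)] fac_lin_eq_emb[OF skew_poly_ring_axioms \<Theta>\<alpha>(2)]
      fac_quad_eq_emb[OF skew_poly_ring_axioms \<Theta>\<alpha>(1)] fac_quad_eq_emb[OF skew_poly_ring_axioms \<Theta>\<alpha>(2)]
    by (simp_all add: g_def b_simps[unfolded One_nat_def] \<alpha>_inv)
  have XN: "skp_add (skp_pow k \<Theta> skp_X N) (skp_const 1) = emb P"
  proof -
    have "fixed_poly [:0, 1:]" using \<Theta>1 by (auto intro!: fixed_poly_pCons)
    then show ?thesis
      by (simp add: P negacyclic_poly_def emb_add skp_add_eq skp_const_one_eq_emb skp_X_eq_emb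
          emb_power monom_altdef)
  qed
  have fixed_g: "fixed_poly (g i)" if "i < 4" for i
    using fixed_b[OF that] by (simp add: g_def fixed_poly_power)
  have prod: "emb P = skp_mult k \<Theta> (skp_mult k \<Theta> (skp_mult k \<Theta> (emb (g 0)) (emb (g 1))) (emb (g 2))) (emb (g 3))"
    using fixed_g by (simp add: emb_mult[symmetric] P_prod)
  have C: "left_ideal_mod k \<Theta> (emb P) C"
    using assms(11) XN by (simp add: skew_negacyclic_code_def N_def q_def)
  then have D: "left_ideal_mod k \<Theta> (emb P) D"
    unfolding D_def P by (rule left_ideal_mod_euclid_dual[OF N0 \<Theta>N])
  have dual: "D = C \<longleftrightarrow> skrem k \<Theta> (emb (g 0)) ` C = skrem k \<Theta> (emb (g 0)) ` D \<and>
      skrem k \<Theta> (emb (g 1)) ` C = skrem k \<Theta> (emb (g 1)) ` D \<and>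
      skrem k \<Theta> (emb (g 2)) ` C = skrem k \<Theta> (emb (g 2)) ` D \<and>
      skrem k \<Theta> (emb (g 3)) ` C = skrem k \<Theta> (emb (g 3)) ` D"
    using left_ideal_eq_iff[OF A C D] unfolding A(1) by (auto simp: eq_commute)
  show ?thesis
    unfolding Let_def q_def[symmetric] N_def[symmetric] \<alpha>_def[symmetric] f D_def[symmetric] XN
    using crt_map_bij_betw[OF A] left_ideal_component[OF C] left_ideal_component[OF D]
      crt_map_image[OF A C] crt_map_image[OF A D] card_left_ideal[OF A C]
    unfolding degP
    by (intro conjI dual prod) simp_all
qed

end
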